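(* Let $\mathfrak h$ be a CSLAT of dimension $6$ which is not isomorphic to $\mathfrak h_{13}$, $\mathfrak h_{19}^+$ nor $\mathfrak h_{26}^-$, let $H$ be the associated simply connected Lie group, and let $\sigma\in\Sigma$, where $\Sigma=\Sigma(F)$ is the submanifold attached to $\mathfrak h$ in the context. Let $g_\sigma=\sigma^T\sigma$ be the corresponding inner product on $\mathfrak h$ (and left-invariant metric on $H$), and let $K=\operatorname{Aut}(\mathfrak h)\cap\operatorname O(g_\sigma)$ be the full isotropy group of $(H,g_\sigma)$ at the identity. Then $K\subset D$, where $D\subset\operatorname{Aut}(\mathfrak h)$ is the finite subgroup described in the context.
   Context: A real nilpotent Lie algebra $\mathfrak h$ is a CSLAT if $\operatorname{Der}(\mathfrak h)$ is solvable and every $D\in\operatorname{Der}(\mathfrak h)$ has only real eigenvalues. A tuple such as $(0,0,0,12,13,14+23)$ denotes $\mathbb R^6$ with canonical basis $e_1,\dots,e_6$, where a term $ij$ in the $k$-th entry contributes $-e_k$ to $[e_i,e_j]$ (and a term preceded by a minus sign contributes $+e_k$); all other brackets vanish up to skew-symmetry. Every 6-dimensional CSLAT is isomorphic to exactly one of the Lie algebras in the list below or to one of $\mathfrak h_{13}=(0,0,0,12,13+14,24)$, $\mathfrak h_{19}^+=(0,0,0,23,21,14+35)$, $\mathfrak h_{26}^-=(0,0,12,31,32,15+24)$, and is identified with it; $e_1,\dots,e_6$ is its standard basis. Linear maps and bilinear forms on $\mathfrak h$ are identified with matrices in the standard basis: $g_\sigma(e_i,e_j)=(\sigma^T\sigma)_{ij}$,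 and $\operatorname O(g_\sigma)$ is the group of $\varphi\in\operatorname{GL}_6(\mathbb R)$ with $\varphi^Tg_\sigma\varphi=g_\sigma$. The isometry group satisfies $\operatorname I(H,g_\sigma)\simeq H\rtimes K$ with $K\simeq\operatorname{Aut}(\mathfrak h)\cap\operatorname O(g_\sigma)$ via the isotropy representation. For a set $F$ of positions $(i,j)$, $i\ge j$ (written $ij$), $\Sigma(F)$ is the set of lower triangular real $6\times6$ matrices $\sigma$ with: $\sigma_{ij}\in\mathbb R$ arbitrary if $i>j$ and $ij\in F$; $\sigma_{ij}=0$ if $i>j$ and $ij\notin F$; $\sigma_{ii}>0$ arbitrary if $ii\in F$; $\sigma_{ii}=1$ if $ii\notin F$. The list (Lie algebra in standard basis; $F$): $\mathfrak h_9=(0,0,0,0,12,51+23)$; $F=\{33,53,54,55,65,66\}$. $\mathfrak h_{10}=(0,0,0,12,13,14)$; $F=\{44,54,55,64,65,66\}$. $\mathfrak h_{11}=(0,0,0,12,13,14+23)$; $F=\{33,44,54,55,64,65,66\}$. $\mathfrak h_{12}=(0,0,0,12,13,24)$; $F=\{21,43,44,54,55,64,65,66\}$. $\mathfrak h_{14}=(0,0,0,12,14,13+42)$; $F=\{33,43,44,54,55,64,65,66\}$. $\mathfrak h_{18}=(0,0,0,12,13,15+24)$; $F=\{32,33,43,44,54,55,64,65,66\}$. $\mathfrak h_{21}=(0,0,0,12,14,15)$; $F=\{43,44,53,54,55,64,65,66\}$. $\mathfrak h_{22}=(0,0,0,12,14,15+24)$; $F=\{22,43,44,53,54,55,64,65,66\}$.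 $\mathfrak h_{23}=(0,0,12,13,23,14)$; $F=\{33,43,44,53,54,55,63,64,65,66\}$. $\mathfrak h_{24}=(0,0,0,12,14,15+23+24)$; $F=\{22,33,43,44,53,54,55,64,65,66\}$. $\mathfrak h_{25}=(0,0,0,12,14,15+23)$; $F=\{33,43,44,53,54,55,64,65,66\}$. $\mathfrak h_{27}=(0,0,0,12,14-23,15+34)$; $F=\{31,32,33,43,44,53,54,55,64,65,66\}$. $\mathfrak h_{28}=(0,0,12,13,14,15)$; $F=\{33,43,44,53,54,55,63,64,65,66\}$. $\mathfrak h_{29}=(0,0,12,13,14,23+15)$; $F=\{22,33,43,44,53,54,55,63,64,65,66\}$. $\mathfrak h_{30}=(0,0,12,13,14+23,24+15)$; $F=\{21,22,33,43,44,53,54,55,63,64,65,66\}$. $\mathfrak h_{31}=(0,0,12,13,14,34+52)$; $F=\{21,33,42,43,44,53,54,55,63,64,65,66\}$. $\mathfrak h_{32}=(0,0,12,13,14+23,34+52)$; $F=\{21,22,33,42,43,44,53,54,55,63,64,65,66\}$. For each of these Lie algebras, $D$ is the finite group of all automorphisms of $\mathfrak h$ whose matrix in the standard basis is diagonal with entries $\pm1$; it satisfies $\operatorname{Aut}(\mathfrak h)=\operatorname{Aut}_0(\mathfrak h)\rtimes D$, with $\operatorname{Aut}_0(\mathfrak h)$ the identity component. *)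

theory Defs
  imports "HOL-Analysis.Analysis"
begin

text \<open>
  A Lie algebra structure on a space is given by its bracket. The inner product that comes with the
  class \<open>euclidean_space\<close> plays no role; the class only provides finite dimension over the reals.
\<close>

definition lie_bracket :: "('a::real_vector \<Rightarrow> 'a \<Rightarrow> 'a) \<Rightarrow> bool" where
  "lie_bracket L \<longleftrightarrow>
     (\<forall>x. linear (L x)) \<and> (\<forall>y. linear (\<lambda>x. L x y)) \<and>
     (\<forall>x. L x x = 0) \<and>
     (\<forall>x y z. L x (L y z) + L y (L z x) + L z (L x y) = 0)"

definition bracket_span :: "('a::real_vector \<Rightarrow> 'a \<Rightarrow> 'a) \<Rightarrow> 'a set \<Rightarrow> 'a set \<Rightarrow> 'a set" where
  "bracket_span L S T = span {L x y | x y. x \<in> S \<and> y \<in> T}"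

fun lower_central_series :: "('a::real_vector \<Rightarrow> 'a \<Rightarrow> 'a) \<Rightarrow> 'a set \<Rightarrow> nat \<Rightarrow> 'a set" where
  "lower_central_series L S 0 = S"
| "lower_central_series L S (Suc n) = bracket_span L S (lower_central_series L S n)"

fun derived_series :: "('a::real_vector \<Rightarrow> 'a \<Rightarrow> 'a) \<Rightarrow> 'a set \<Rightarrow> nat \<Rightarrow> 'a set" where
  "derived_series L S 0 = S"
| "derived_series L S (Suc n) =
     bracket_span L (derived_series L S n) (derived_series L S n)"

definition lie_nilpotent :: "('a::real_vector \<Rightarrow> 'a \<Rightarrow> 'a) \<Rightarrow> 'a set \<Rightarrow> bool" where
  "lie_nilpotent L S \<longleftrightarrow> (\<exists>n. lower_central_series L S n = {0})"

definition lie_solvable :: "('a::real_vector \<Rightarrow> 'a \<Rightarrow> 'a) \<Rightarrow> 'a set \<Rightarrow> bool" where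
  "lie_solvable L S \<longleftrightarrow> (\<exists>n. derived_series L S n = {0})"

text \<open>Every linear endomorphism of a Euclidean space is bounded, so \<open>'a \<Rightarrow>\<^sub>L 'a\<close> is all of \<open>gl('a)\<close>.\<close>

definition commutator :: "('a::euclidean_space \<Rightarrow>\<^sub>L 'a) \<Rightarrow> ('a \<Rightarrow>\<^sub>L 'a) \<Rightarrow> ('a \<Rightarrow>\<^sub>L 'a)" where
  "commutator D E = D o\<^sub>L E - E o\<^sub>L D"

definition derivations :: "('a::euclidean_space \<Rightarrow> 'a \<Rightarrow> 'a) \<Rightarrow> ('a \<Rightarrow>\<^sub>L 'a) set" where
  "derivations L = {D. \<forall>x y. blinfun_apply D (L x y) =
     L (blinfun_apply D x) y + L x (blinfun_apply D y)}"

text \<open>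
  \<open>z\<close> is an eigenvalue of the complexification of \<open>D\<close>, with eigenvector \<open>u + \<i> v\<close>.
\<close>

definition complex_eigenvalue :: "('a::euclidean_space \<Rightarrow>\<^sub>L 'a) \<Rightarrow> complex \<Rightarrow> bool" where
  "complex_eigenvalue D z \<longleftrightarrow>
     (\<exists>u v. (u \<noteq> 0 \<or> v \<noteq> 0) \<and>
        blinfun_apply D u = Re z *\<^sub>R u - Im z *\<^sub>R v \<and>
        blinfun_apply D v = Im z *\<^sub>R u + Re z *\<^sub>R v)"

definition cslat :: "('a::euclidean_space \<Rightarrow> 'a \<Rightarrow> 'a) \<Rightarrow> bool" where
  "cslat L \<longleftrightarrow> lie_bracket L \<and> lie_nilpotent L UNIV \<and>
     lie_solvable commutator (derivations L) \<and>
     (\<forall>D \<in> derivations L. \<forall>z. complex_eigenvalue D z \<longrightarrow> z \<in> \<real>)"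

definition lie_iso ::
  "('a::real_vector \<Rightarrow> 'a \<Rightarrow> 'a) \<Rightarrow> ('b::real_vector \<Rightarrow> 'b \<Rightarrow> 'b) \<Rightarrow> ('a \<Rightarrow> 'b) \<Rightarrow> bool" where
  "lie_iso L M \<theta> \<longleftrightarrow> linear \<theta> \<and> bij \<theta> \<and> (\<forall>x y. \<theta> (L x y) = M (\<theta> x) (\<theta> y))"

definition lie_isomorphic ::
  "('a::real_vector \<Rightarrow> 'a \<Rightarrow> 'a) \<Rightarrow> ('b::real_vector \<Rightarrow> 'b \<Rightarrow> 'b) \<Rightarrow> bool" where
  "lie_isomorphic L M \<longleftrightarrow> (\<exists>\<theta>. lie_iso L M \<theta>)"

definition lie_aut :: "('a::real_vector \<Rightarrow> 'a \<Rightarrow> 'a) \<Rightarrow> ('a \<Rightarrow> 'a) set" where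
  "lie_aut L = {\<phi>. lie_iso L L \<phi>}"

text \<open>
  Positions are numbered 1, ..., 6 and embedded into the index type \<open>6\<close> (the integers modulo 6)
  by \<open>of_nat\<close>; this is a bijection, with position 6 going to \<open>0 :: 6\<close>. The order of the type \<open>6\<close>
  is never used. A tuple such as (0,0,0,12,14-23,15+34) is written
  \<open>[[], [], [], [12], [14, -23], [15, 34]]\<close>: the entry \<open>\<plusminus>ij\<close> is the two-digit integer
  \<open>\<plusminus>(10 i + j)\<close>. A term \<open>ij\<close> in the \<open>k\<close>-th entry means \<open>[e\<^sub>i, e\<^sub>j] = - [e\<^sub>j, e\<^sub>i] = - e\<^sub>k + ...\<close>.
\<close>

definition std_basis :: "nat \<Rightarrow> real^6" where
  "std_basis k = axis (of_nat k) 1"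

definition term_value :: "int \<Rightarrow> real^6 \<Rightarrow> real^6 \<Rightarrow> real" where
  "term_value t x y =
     (let i = of_int (\<bar>t\<bar> div 10); j = of_int (\<bar>t\<bar> mod 10)
      in - of_int (sgn t) * (x $ i * y $ j - x $ j * y $ i))"

definition tuple_bracket :: "int list list \<Rightarrow> real^6 \<Rightarrow> real^6 \<Rightarrow> real^6" where
  "tuple_bracket T x y =
     (\<Sum>k = 1..6. (\<Sum>t\<leftarrow>T ! (k - 1). term_value t x y) *\<^sub>R std_basis k)"

definition h13 :: "real^6 \<Rightarrow> real^6 \<Rightarrow> real^6" where
  "h13 = tuple_bracket [[], [], [], [12], [13, 14], [24]]"

definition h19_plus :: "real^6 \<Rightarrow> real^6 \<Rightarrow> real^6" where
  "h19_plus = tuple_bracket [[], [], [], [23], [21], [14, 35]]"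

definition h26_minus :: "real^6 \<Rightarrow> real^6 \<Rightarrow> real^6" where
  "h26_minus = tuple_bracket [[], [], [12], [31], [32], [15, 24]]"

text \<open>
  The remaining six-dimensional CSLATs
  \<open>h\<^sub>9, h\<^sub>1\<^sub>0, h\<^sub>1\<^sub>1, h\<^sub>1\<^sub>2, h\<^sub>1\<^sub>4, h\<^sub>1\<^sub>8, h\<^sub>2\<^sub>1, h\<^sub>2\<^sub>2, h\<^sub>2\<^sub>3, h\<^sub>2\<^sub>4, h\<^sub>2\<^sub>5, h\<^sub>2\<^sub>7, h\<^sub>2\<^sub>8, h\<^sub>2\<^sub>9, h\<^sub>3\<^sub>0, h\<^sub>3\<^sub>1, h\<^sub>3\<^sub>2\<close>
  in this order, each with its set of positions \<open>F\<close> (again \<open>ij\<close> stands for \<open>10 i + j\<close>).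
\<close>

definition cslat_table :: "(int list list \<times> nat set) set" where
  "cslat_table = {
     ([[], [], [], [], [12], [51, 23]], {33, 53, 54, 55, 65, 66}),
     ([[], [], [], [12], [13], [14]], {44, 54, 55, 64, 65, 66}),
     ([[], [], [], [12], [13], [14, 23]], {33, 44, 54, 55, 64, 65, 66}),
     ([[], [], [], [12], [13], [24]], {21, 43, 44, 54, 55, 64, 65, 66}),
     ([[], [], [], [12], [14], [13, 42]], {33, 43, 44, 54, 55, 64, 65, 66}),
     ([[], [], [], [12], [13], [15, 24]], {32, 33, 43, 44, 54, 55, 64, 65, 66}),
     ([[], [], [], [12], [14], [15]], {43, 44, 53, 54, 55, 64, 65, 66}),
     ([[], [], [], [12], [14], [15, 24]], {22, 43, 44, 53, 54, 55, 64, 65, 66}),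
     ([[], [], [12], [13], [23], [14]], {33, 43, 44, 53, 54, 55, 63, 64, 65, 66}),
     ([[], [], [], [12], [14], [15, 23, 24]], {22, 33, 43, 44, 53, 54, 55, 64, 65, 66}),
     ([[], [], [], [12], [14], [15, 23]], {33, 43, 44, 53, 54, 55, 64, 65, 66}),
     ([[], [], [], [12], [14, -23], [15, 34]], {31, 32, 33, 43, 44, 53, 54, 55, 64, 65, 66}),
     ([[], [], [12], [13], [14], [15]], {33, 43, 44, 53, 54, 55, 63, 64, 65, 66}),
     ([[], [], [12], [13], [14], [23, 15]], {22, 33, 43, 44, 53, 54, 55, 63, 64, 65, 66}),
     ([[], [], [12], [13], [14, 23], [24, 15]], {21, 22, 33, 43, 44, 53, 54, 55, 63, 64, 65, 66}),
     ([[], [], [12], [13], [14], [34, 52]], {21, 33, 42, 43, 44, 53, 54, 55, 63, 64, 65, 66}),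
     ([[], [], [12], [13], [14, 23], [34, 52]],
        {21, 22, 33, 42, 43, 44, 53, 54, 55, 63, 64, 65, 66})}"

definition Sigma_mats :: "nat set \<Rightarrow> (real^6^6) set" where
  "Sigma_mats F = {\<sigma>. \<forall>i\<in>{1..6}. \<forall>j\<in>{1..6}.
     (let s = \<sigma> $ of_nat i $ of_nat j in
        (i < j \<longrightarrow> s = 0) \<and>
        (i > j \<and> 10 * i + j \<notin> F \<longrightarrow> s = 0) \<and>
        (i = j \<and> 10 * i + j \<in> F \<longrightarrow> s > 0) \<and>
        (i = j \<and> 10 * i + j \<notin> F \<longrightarrow> s = 1))}"

definition metric_mat :: "real^6^6 \<Rightarrow> real^6^6" where
  "metric_mat \<sigma> = transpose \<sigma> ** \<sigma>"

definition metric_orthogonal_group :: "real^6^6 \<Rightarrow> (real^6^6) set" where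
  "metric_orthogonal_group g = {A. invertible A \<and> transpose A ** g ** A = g}"

text \<open>
  A Lie algebra isomorphism \<open>\<theta>\<close> onto one of the algebras on \<open>\<real>\<^sup>6\<close> above identifies the two; the standard
  basis corresponds to \<open>inv \<theta> (std_basis k)\<close>, and endomorphisms become matrices as follows.
\<close>

definition matrix_in_std_basis :: "('a::real_vector \<Rightarrow> real^6) \<Rightarrow> ('a \<Rightarrow> 'a) \<Rightarrow> real^6^6" where
  "matrix_in_std_basis \<theta> \<phi> = matrix (\<theta> \<circ> \<phi> \<circ> inv \<theta>)"

definition isotropy_group ::
  "('a::real_vector \<Rightarrow> 'a \<Rightarrow> 'a) \<Rightarrow> ('a \<Rightarrow> real^6) \<Rightarrow> real^6^6 \<Rightarrow> ('a \<Rightarrow> 'a) set" where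
  "isotropy_group L \<theta> \<sigma> =
     {\<phi> \<in> lie_aut L. matrix_in_std_basis \<theta> \<phi> \<in> metric_orthogonal_group (metric_mat \<sigma>)}"

definition diagonal_sign_auts ::
  "('a::real_vector \<Rightarrow> 'a \<Rightarrow> 'a) \<Rightarrow> ('a \<Rightarrow> real^6) \<Rightarrow> ('a \<Rightarrow> 'a) set" where
  "diagonal_sign_auts L \<theta> =
     {\<phi> \<in> lie_aut L. \<forall>i j.
        (i \<noteq> j \<longrightarrow> matrix_in_std_basis \<theta> \<phi> $ i $ j = 0) \<and>
        matrix_in_std_basis \<theta> \<phi> $ i $ i \<in> {1, -1}}"

end

theory Submission
  imports Defs
begin

text \<open>
  Transport an isotropy element along \<open>\<theta>\<close>: it becomes an automorphism \<open>\<phi>\<close> of one of the listed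
  algebras on \<open>\<real>\<^sup>6\<close> that preserves the inner product \<open>\<sigma>\<^sup>T\<sigma>\<close>. It has to be shown that \<open>\<phi>\<close> maps each
  standard basis vector to plus or minus itself.

  Two sources supply invariant coordinate subspaces, that is, spans of some of the \<open>e\<^sub>k\<close>. The first is
  the Lie algebra alone: every subspace built from invariant ones by brackets, sums,
  intersections and transporters \<open>{x. [x, U] \<subseteq> W}\<close> (centre, centralizers, ...) is invariant
  (lemmas \<open>stable_bracket\<close>, \<open>stable_Un\<close>, \<open>stable_Int\<close>, \<open>stable_transporter\<close>). In each algebra of the list
  these constructions produce the full flag \<open>span {e\<^sub>k, ..., e\<^sub>6}\<close>, so \<open>\<phi>\<close> is lower triangular; only for
  \<open>h\<^sub>1\<^sub>4\<close> one further intrinsic description is required.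

  The second source is the metric. Since \<open>\<sigma>\<close> and \<open>\<phi>\<close> are both lower triangular, \<open>\<sigma> \<phi>\<close> and \<open>\<sigma>\<close> are
  triangular matrices with the same Gram matrix, and such a matrix is unique up to the signs
  of its rows: \<open>\<sigma> \<phi> = \<epsilon> \<sigma>\<close> with a diagonal sign matrix \<open>\<epsilon>\<close> (lemma \<open>row_sign\<close>). Comparing entries
  row by row, column \<open>j\<close> of \<open>\<phi>\<close> can leave the diagonal only through positions that are free in
  column \<open>j\<close> of \<open>\<sigma>\<close>. If those few entries of \<open>\<phi>\<close> vanish, which usually follows from a further invariant
  subspace containing \<open>e\<^sub>j\<close>, then the line of \<open>e\<^sub>j\<close> is invariant (lemmas \<open>stable_line_of_column\<close>
  and \<open>stable_line\<close>). Feeding these lines back into the first source reaches every generator of the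
  algebra, except that in each of \<open>h\<^sub>2\<^sub>7\<close>, \<open>h\<^sub>3\<^sub>0\<close>, \<open>h\<^sub>3\<^sub>1\<close>, \<open>h\<^sub>3\<^sub>2\<close> one free entry \<open>c\<close> of one column survives.
  It is killed by a further bracket relation between the images of basis vectors, in which two
  contributions of \<open>c\<close> add up instead of cancelling: twice \<open>c\<close> times a nonzero number is zero.

  Finally every other basis vector is up to sign a bracket of two earlier ones, so it is an
  eigenvector as well, and the diagonal entries are signs because of \<open>\<sigma> \<phi> = \<epsilon> \<sigma>\<close> (lemma \<open>diagonal_from_generators\<close>).
\<close>

section \<open>Coordinates on the six-dimensional space\<close>

text \<open>Numerals for positions are compared literally below, so \<open>1\<close> must not turn into \<open>Suc 0\<close>.\<close>

declare One_nat_def [simp del]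

lemma positions: "{1..6::nat} = {1, 2, 3, 4, 5, 6}"
  by auto

lemma bij_positions: "bij_betw (of_nat :: nat \<Rightarrow> 6) {1..6} UNIV"
proof -
  have inj: "inj_on (of_nat :: nat \<Rightarrow> 6) {1..6}"
    unfolding positions by simp
  then have "of_nat ` {1..6} = (UNIV :: 6 set)"
    by (intro card_subset_eq) (simp_all add: card_image)
  with inj show ?thesis
    by (simp add: bij_betw_def)
qed

lemma all_positions: "(\<forall>i::6. P i) \<longleftrightarrow> (\<forall>k\<in>{1..6}. P (of_nat k))"
  using bij_positions by (metis UNIV_I bij_betw_iff_bijections)

lemma sum_positions: "(\<Sum>i\<in>(UNIV :: 6 set). f i) = (\<Sum>k = 1..6. f (of_nat k))"
  using sum.reindex_bij_betw[OF bij_positions, of f] by simp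

lemma vec6_eq_iff:
  "(x :: real^6) = y \<longleftrightarrow>
     x $ 1 = y $ 1 \<and> x $ 2 = y $ 2 \<and> x $ 3 = y $ 3 \<and> x $ 4 = y $ 4 \<and> x $ 5 = y $ 5 \<and> x $ 6 = y $ 6"
  unfolding vec_eq_iff all_positions positions by simp

lemma std_basis_nth:
  assumes "j \<in> {1..6}" "k \<in> {1..6}"
  shows "std_basis j $ of_nat k = (if j = k then 1 else 0)"
proof -
  have "(of_nat k :: 6) = of_nat j \<longleftrightarrow> k = j"
    using bij_positions assms by (auto simp: bij_betw_def inj_on_def)
  then show ?thesis
    by (auto simp: std_basis_def axis_def)
qed

lemma std_basis_expansion: "x = (\<Sum>k = 1..6. x $ of_nat k *\<^sub>R std_basis k)"
  unfolding vec_eq_iff all_positions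
proof
  fix j :: nat assume j: "j \<in> {1..6}"
  have "(\<Sum>k = 1..6. x $ of_nat k *\<^sub>R std_basis k) $ of_nat j
      = (\<Sum>k = 1..6. if k = j then x $ of_nat k else 0)"
    unfolding sum_component by (intro sum.cong refl) (use j in \<open>simp add: std_basis_nth\<close>)
  with j show "x $ of_nat j = (\<Sum>k = 1..6. x $ of_nat k *\<^sub>R std_basis k) $ of_nat j"
    by simp
qed

definition coord :: "nat set \<Rightarrow> (real^6) set" where
  "coord S = {x. \<forall>k\<in>{1..6}. k \<notin> S \<longrightarrow> x $ of_nat k = 0}"

lemma coord_iff:
  "x \<in> coord S \<longleftrightarrow>
     (1 \<in> S \<or> x $ 1 = 0) \<and> (2 \<in> S \<or> x $ 2 = 0) \<and> (3 \<in> S \<or> x $ 3 = 0) \<and>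
     (4 \<in> S \<or> x $ 4 = 0) \<and> (5 \<in> S \<or> x $ 5 = 0) \<and> (6 \<in> S \<or> x $ 6 = 0)"
  unfolding coord_def positions by auto

lemma subspace_coord: "subspace (coord S)"
  by (auto simp: coord_def subspace_def)

lemma std_basis_in_coord: "j \<in> S \<Longrightarrow> j \<in> {1..6} \<Longrightarrow> std_basis j \<in> coord S"
  by (auto simp: coord_def std_basis_nth)

lemma coord_as_span:
  assumes "S \<subseteq> {1..6}"
  shows "coord S = span (std_basis ` S)"
proof
  show "span (std_basis ` S) \<subseteq> coord S"
    using assms by (intro span_minimal subspace_coord) (auto intro: std_basis_in_coord)
  show "coord S \<subseteq> span (std_basis ` S)"
  proof
    fix x assume x: "x \<in> coord S"
    have "(\<Sum>k = 1..6. x $ of_nat k *\<^sub>R std_basis k) \<in> span (std_basis ` S)"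
    proof (intro span_sum)
      fix k :: nat assume "k \<in> {1..6}"
      with x show "x $ of_nat k *\<^sub>R std_basis k \<in> span (std_basis ` S)"
        by (cases "k \<in> S") (auto simp: coord_def span_base span_mul span_zero)
    qed
    then show "x \<in> span (std_basis ` S)"
      by (subst std_basis_expansion)
  qed
qed

lemma std_basis_table:
  "std_basis 1 $ 1 = 1" "std_basis 1 $ 2 = 0" "std_basis 1 $ 3 = 0"
  "std_basis 1 $ 4 = 0" "std_basis 1 $ 5 = 0" "std_basis 1 $ 6 = 0"
  "std_basis 2 $ 1 = 0" "std_basis 2 $ 2 = 1" "std_basis 2 $ 3 = 0"
  "std_basis 2 $ 4 = 0" "std_basis 2 $ 5 = 0" "std_basis 2 $ 6 = 0"
  "std_basis 3 $ 1 = 0" "std_basis 3 $ 2 = 0" "std_basis 3 $ 3 = 1"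
  "std_basis 3 $ 4 = 0" "std_basis 3 $ 5 = 0" "std_basis 3 $ 6 = 0"
  "std_basis 4 $ 1 = 0" "std_basis 4 $ 2 = 0" "std_basis 4 $ 3 = 0"
  "std_basis 4 $ 4 = 1" "std_basis 4 $ 5 = 0" "std_basis 4 $ 6 = 0"
  "std_basis 5 $ 1 = 0" "std_basis 5 $ 2 = 0" "std_basis 5 $ 3 = 0"
  "std_basis 5 $ 4 = 0" "std_basis 5 $ 5 = 1" "std_basis 5 $ 6 = 0"
  "std_basis 6 $ 1 = 0" "std_basis 6 $ 2 = 0" "std_basis 6 $ 3 = 0"
  "std_basis 6 $ 4 = 0" "std_basis 6 $ 5 = 0" "std_basis 6 $ 6 = 1"
  by (simp_all add: std_basis_def axis_def)

section \<open>The bracket of a tuple\<close>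

lemma tuple_bracket_nth:
  assumes "k \<in> {1..6}"
  shows "tuple_bracket T x y $ of_nat k = (\<Sum>t\<leftarrow>T ! (k - 1). term_value t x y)"
proof -
  have "tuple_bracket T x y $ of_nat k
      = (\<Sum>j = 1..6. if j = k then (\<Sum>t\<leftarrow>T ! (j - 1). term_value t x y) else 0)"
    unfolding tuple_bracket_def sum_component
    by (intro sum.cong refl) (use assms in \<open>simp add: std_basis_nth\<close>)
  with assms show ?thesis
    by simp
qed

lemma tuple_bracket_coordinates:
  "tuple_bracket T x y $ 1 = (\<Sum>t\<leftarrow>T ! 0. term_value t x y)"
  "tuple_bracket T x y $ 2 = (\<Sum>t\<leftarrow>T ! 1. term_value t x y)"
  "tuple_bracket T x y $ 3 = (\<Sum>t\<leftarrow>T ! 2. term_value t x y)"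
  "tuple_bracket T x y $ 4 = (\<Sum>t\<leftarrow>T ! 3. term_value t x y)"
  "tuple_bracket T x y $ 5 = (\<Sum>t\<leftarrow>T ! 4. term_value t x y)"
  "tuple_bracket T x y $ 6 = (\<Sum>t\<leftarrow>T ! 5. term_value t x y)"
  using tuple_bracket_nth[of 1 T x y] tuple_bracket_nth[of 2 T x y] tuple_bracket_nth[of 3 T x y]
    tuple_bracket_nth[of 4 T x y] tuple_bracket_nth[of 5 T x y] tuple_bracket_nth[of 6 T x y]
  by (simp_all add: One_nat_def)

lemma linear_tuple_bracket: "linear (tuple_bracket T x)"
proof
  have add: "term_value t x (y + z) = term_value t x y + term_value t x z" for t y z
    by (simp add: term_value_def Let_def algebra_simps)
  have scale: "term_value t x (c *\<^sub>R y) = c * term_value t x y" for t c y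
    by (simp add: term_value_def Let_def algebra_simps)
  show "tuple_bracket T x (y + z) = tuple_bracket T x y + tuple_bracket T x z" for y z
    by (simp add: tuple_bracket_def add sum_list_addf scaleR_add_left sum.distrib)
  show "tuple_bracket T x (c *\<^sub>R y) = c *\<^sub>R tuple_bracket T x y" for c y
    by (simp add: tuple_bracket_def scale sum_list_const_mult scaleR_sum_right)
qed

lemma linear_tuple_bracket_left: "linear (\<lambda>x. tuple_bracket T x y)"
proof -
  have "tuple_bracket T x y = - tuple_bracket T y x" for x
  proof -
    have "term_value t x y = - term_value t y x" for t
      by (simp add: term_value_def Let_def algebra_simps)
    then show ?thesis
      by (simp add: tuple_bracket_def uminus_sum_list_map o_def flip: sum_negf scaleR_minus_left)
  qed
  then show ?thesis
    using linear_compose_neg[OF linear_tuple_bracket, of T y] by simp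
qed

text \<open>
  With these rules the simplifier decides statements on brackets and coordinate
  subspaces of one concrete algebra, as linear equations between the six coordinates.
\<close>

lemmas coordinate_simps =
  coord_iff vec6_eq_iff tuple_bracket_coordinates term_value_def Let_def std_basis_table

section \<open>Invariant coordinate subspaces of an automorphism\<close>

locale tuple_automorphism =
  fixes T :: "int list list" and \<phi> :: "real^6 \<Rightarrow> real^6"
  assumes linear: "linear \<phi>" and bij: "bij \<phi>"
    and hom: "\<phi> (tuple_bracket T x y) = tuple_bracket T (\<phi> x) (\<phi> y)"
begin

text \<open>
  The equivalence, rather than one inclusion, makes stability pass to every subspace that is
  definable from stable ones, with quantifiers over vectors substituted along the bijection \<open>\<phi>\<close>.
\<close>

definition stable :: "nat set \<Rightarrow> bool" where
  "stable S \<longleftrightarrow> (\<forall>x. \<phi> x \<in> coord S \<longleftrightarrow> x \<in> coord S)"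

lemma ball_image: "(\<forall>y. P y) \<longleftrightarrow> (\<forall>x. P (\<phi> x))"
  using bij by (metis bij_pointE)

lemma bex_image: "(\<exists>y. P y) \<longleftrightarrow> (\<exists>x. P (\<phi> x))"
  using bij by (metis bij_pointE)

lemma phi_eq_0_iff: "\<phi> x = 0 \<longleftrightarrow> x = 0"
  using bij linear by (metis bij_pointE linear_0)

lemma stable_all: "stable {1, 2, 3, 4, 5, 6}"
  by (simp add: stable_def coord_iff)

lemma stable_zero: "stable {}"
proof -
  have "x \<in> coord {} \<longleftrightarrow> x = 0" for x
    by (simp add: coord_iff vec6_eq_iff)
  then show ?thesis
    by (simp add: stable_def phi_eq_0_iff)
qed

lemma stable_Int: "stable U \<Longrightarrow> stable W \<Longrightarrow> stable (U \<inter> W)"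
proof -
  have "coord (U \<inter> W) = coord U \<inter> coord W"
    by (auto simp: coord_def)
  then show "stable U \<Longrightarrow> stable W \<Longrightarrow> stable (U \<inter> W)"
    by (simp add: stable_def)
qed

lemma stable_image: "stable S \<longleftrightarrow> \<phi> ` coord S = coord S"
proof -
  have "\<phi> ` coord S = coord S \<longleftrightarrow> \<phi> -` coord S = coord S"
    using bij by (metis bij_is_inj bij_is_surj inj_vimage_image_eq surj_image_vimage_eq)
  then show ?thesis
    by (auto simp: stable_def)
qed

lemma stable_Un:
  assumes "stable U" "stable W" "U \<union> W \<subseteq> {1..6}"
  shows "stable (U \<union> W)"
proof -
  have "coord (U \<union> W) = span (coord U \<union> coord W)"
    using assms(3) by (simp add: coord_as_span span_Un image_Un span_span)
  moreover have "\<phi> ` span (coord U \<union> coord W) = span (coord U \<union> coord W)"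
    using assms(1,2) by (simp add: linear_span_image[OF linear, symmetric] image_Un stable_image)
  ultimately show ?thesis
    by (simp add: stable_image)
qed

text \<open>
  The last premise describes \<open>coord S\<close> as the transporter \<open>{x. [x, U] \<subseteq> W}\<close>; testing
  it on the basis vectors of \<open>U\<close> suffices by linearity.
\<close>

lemma stable_transporter:
  assumes "stable U" "stable W" "U \<subseteq> {1..6}"
    and S: "\<And>x. x \<in> coord S \<longleftrightarrow> (\<forall>u\<in>U. tuple_bracket T x (std_basis u) \<in> coord W)"
  shows "stable S"
proof -
  have S': "x \<in> coord S \<longleftrightarrow> (\<forall>u. u \<in> coord U \<longrightarrow> tuple_bracket T x u \<in> coord W)" for x
  proof -
    have "tuple_bracket T x ` coord U = span (tuple_bracket T x ` std_basis ` U)"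
      unfolding coord_as_span[OF assms(3)]
      by (rule linear_span_image[OF linear_tuple_bracket, symmetric])
    moreover have "span (tuple_bracket T x ` std_basis ` U) \<subseteq> coord W
        \<longleftrightarrow> tuple_bracket T x ` std_basis ` U \<subseteq> coord W"
      by (metis span_minimal span_superset subset_trans subspace_coord)
    ultimately have "tuple_bracket T x ` coord U \<subseteq> coord W
        \<longleftrightarrow> tuple_bracket T x ` std_basis ` U \<subseteq> coord W"
      by simp
    then have "(\<forall>u\<in>coord U. tuple_bracket T x u \<in> coord W)
        \<longleftrightarrow> (\<forall>u\<in>U. tuple_bracket T x (std_basis u) \<in> coord W)"
      by (simp add: image_subset_iff)
    then show ?thesis
      by (auto simp: S)
  qed
  show ?thesis
    unfolding stable_def
  proof
    fix x
    have "\<phi> x \<in> coord S \<longleftrightarrow> (\<forall>u. \<phi> u \<in> coord U \<longrightarrow> tuple_bracket T (\<phi> x) (\<phi> u) \<in> coord W)"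
      unfolding S' by (rule ball_image)
    also have "\<dots> \<longleftrightarrow> x \<in> coord S"
      using assms(1,2) by (simp add: S' stable_def flip: hom)
    finally show "\<phi> x \<in> coord S \<longleftrightarrow> x \<in> coord S" .
  qed
qed

text \<open>
  The last two premises say that \<open>coord S\<close> is the subspace \<open>[U, W]\<close>. In all algebras of
  the list a bracket of two basis vectors is zero or a basis vector up to sign.
\<close>

lemma stable_bracket:
  assumes "stable U" "stable W" "U \<subseteq> {1..6}" "W \<subseteq> {1..6}" "S \<subseteq> {1..6}"
    and sub: "\<And>x y. x \<in> coord U \<Longrightarrow> y \<in> coord W \<Longrightarrow> tuple_bracket T x y \<in> coord S"
    and gen: "\<forall>k\<in>S. \<exists>u\<in>U. \<exists>w\<in>W. tuple_bracket T (std_basis u) (std_basis w) = - std_basis k \<or>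
               tuple_bracket T (std_basis u) (std_basis w) = std_basis k"
  shows "stable S"
proof -
  let ?P = "(\<lambda>(x, y). tuple_bracket T x y) ` (coord U \<times> coord W)"
  have "std_basis k \<in> span ?P" if k: "k \<in> S" for k
  proof -
    from gen k obtain u w where uw: "u \<in> U" "w \<in> W" and b:
      "tuple_bracket T (std_basis u) (std_basis w) = - std_basis k \<or>
       tuple_bracket T (std_basis u) (std_basis w) = std_basis k" by blast
    have "std_basis u \<in> coord U" "std_basis w \<in> coord W"
      using uw assms(3,4) by (auto intro: std_basis_in_coord)
    then have "tuple_bracket T (std_basis u) (std_basis w) \<in> span ?P"
      by (intro span_base) force
    from b this span_neg[OF this] show ?thesis
      by auto
  qed
  then have "span (std_basis ` S) \<subseteq> span ?P"
    by (intro span_minimal subspace_span) blast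
  moreover have "span ?P \<subseteq> coord S"
    using sub by (intro span_minimal subspace_coord) auto
  ultimately have "coord S = span ?P"
    unfolding coord_as_span[OF assms(5)] by blast
  moreover have "\<phi> ` ?P = ?P"
  proof -
    have "\<phi> ` ?P = (\<lambda>(x, y). tuple_bracket T x y) ` (\<phi> ` coord U \<times> \<phi> ` coord W)"
      unfolding image_paired_Times[symmetric] image_image by (simp add: hom case_prod_unfold)
    then show ?thesis
      using assms(1,2) by (simp add: stable_image)
  qed
  moreover have "\<phi> ` span ?P = span (\<phi> ` ?P)"
    by (rule linear_span_image[OF linear, symmetric])
  ultimately show ?thesis
    by (simp only: stable_image)
qed

text \<open>
  The vectors of \<open>U\<close> whose centralizer is not contained in \<open>U\<close> form an intrinsically defined set;
  this covers a subspace that transporters do not reach.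
\<close>

lemma stable_noncentralized:
  assumes "stable U"
    and S: "\<And>x. x \<in> coord S \<longleftrightarrow> x \<in> coord U \<and> (\<exists>y. y \<notin> coord U \<and> tuple_bracket T x y = 0)"
  shows "stable S"
  unfolding stable_def
proof
  fix x
  have "\<phi> x \<in> coord S \<longleftrightarrow>
      \<phi> x \<in> coord U \<and> (\<exists>y. \<phi> y \<notin> coord U \<and> tuple_bracket T (\<phi> x) (\<phi> y) = 0)"
    unfolding S using bex_image[of "\<lambda>y. y \<notin> coord U \<and> tuple_bracket T (\<phi> x) y = 0"] by simp
  also have "\<dots> \<longleftrightarrow> x \<in> coord S"
  proof -
    have "tuple_bracket T (\<phi> x) (\<phi> y) = 0 \<longleftrightarrow> tuple_bracket T x y = 0" for y
      by (metis hom phi_eq_0_iff)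
    with assms(1) show ?thesis
      by (simp add: S stable_def)
  qed
  finally show "\<phi> x \<in> coord S \<longleftrightarrow> x \<in> coord S" .
qed

lemma stable_image_in: "stable S \<Longrightarrow> j \<in> S \<Longrightarrow> j \<in> {1..6} \<Longrightarrow> \<phi> (std_basis j) \<in> coord S"
  by (simp add: stable_def std_basis_in_coord)

lemma bracket_neg: "tuple_bracket T x y = - z \<Longrightarrow> tuple_bracket T (\<phi> x) (\<phi> y) = - \<phi> z"
  by (metis hom linear linear_neg)

end

section \<open>Lower triangular matrices with positive diagonal\<close>

lemma row_Sigma_mats:
  assumes "\<sigma> \<in> Sigma_mats F" "i \<in> {1..6}"
  shows "(\<sigma> *v x) $ of_nat i = (\<Sum>k = 1..i. \<sigma> $ of_nat i $ of_nat k * x $ of_nat k)"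
proof -
  have "(\<sigma> *v x) $ of_nat i = (\<Sum>k = 1..6. \<sigma> $ of_nat i $ of_nat k * x $ of_nat k)"
    by (simp add: matrix_vector_mult_def sum_positions)
  also have "\<dots> = (\<Sum>k = 1..i. \<sigma> $ of_nat i $ of_nat k * x $ of_nat k)"
    using assms by (intro sum.mono_neutral_right) (auto simp: Sigma_mats_def Let_def)
  finally show ?thesis .
qed

lemma Sigma_mats_diag_pos:
  assumes "\<sigma> \<in> Sigma_mats F" "i \<in> {1..6}"
  shows "\<sigma> $ of_nat i $ of_nat i > 0"
  using assms by (cases "10 * i + i \<in> F") (auto simp: Sigma_mats_def Let_def)

lemma row_Sigma_mats_zero:
  assumes "\<sigma> \<in> Sigma_mats F" "i \<in> {1..6}" "x \<in> coord {Suc i..6}"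
  shows "(\<sigma> *v x) $ of_nat i = 0"
  unfolding row_Sigma_mats[OF assms(1,2)] using assms by (intro sum.neutral) (auto simp: coord_def)

lemma row_Sigma_mats_leading:
  assumes "\<sigma> \<in> Sigma_mats F" "i \<in> {1..6}" "x \<in> coord {i..6}"
  shows "(\<sigma> *v x) $ of_nat i = \<sigma> $ of_nat i $ of_nat i * x $ of_nat i"
proof -
  have "(\<Sum>k = 1..i. \<sigma> $ of_nat i $ of_nat k * x $ of_nat k)
      = (\<Sum>k \<in> {i}. \<sigma> $ of_nat i $ of_nat k * x $ of_nat k)"
    using assms by (intro sum.mono_neutral_right) (auto simp: coord_def)
  then show ?thesis
    by (simp add: row_Sigma_mats[OF assms(1,2)])
qed

section \<open>Isometric automorphisms\<close>

locale tuple_isometry = tuple_automorphism +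
  fixes F :: "nat set" and \<sigma> :: "real^6^6"
  assumes sigma: "\<sigma> \<in> Sigma_mats F"
    and isometry: "(\<sigma> *v \<phi> x) \<bullet> (\<sigma> *v \<phi> y) = (\<sigma> *v x) \<bullet> (\<sigma> *v y)"
begin

definition triangular :: bool where
  "triangular \<longleftrightarrow> (\<forall>k\<in>{2..6}. stable {k..6})"

lemma triangularI:
  assumes "stable {2, 3, 4, 5, 6}" "stable {3, 4, 5, 6}" "stable {4, 5, 6}" "stable {5, 6}" "stable {6}"
  shows "triangular"
proof -
  have "{2..6::nat} = {2, 3, 4, 5, 6}" "{3..6::nat} = {3, 4, 5, 6}" "{4..6::nat} = {4, 5, 6}"
    "{5..6::nat} = {5, 6}" "{6..6::nat} = {6}" by auto
  with assms show ?thesis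
    by (simp add: triangular_def)
qed

lemma triangular_stable: "triangular \<Longrightarrow> k \<in> {1..6} \<Longrightarrow> stable {k..6}"
  using stable_all by (cases "k = 1") (auto simp: triangular_def positions)

lemma triangular_column:
  assumes triangular "j \<in> {1..6}"
  shows "\<phi> (std_basis j) \<in> coord {j..6}"
  using triangular_stable[OF assms] std_basis_in_coord[of j "{j..6}"] assms(2) by (simp add: stable_def)

text \<open>
  This is the uniqueness of the Cholesky factor up to row signs: the rows of \<open>\<sigma>\<close>, as linear
  functionals \<open>r\<close>, satisfy \<open>r i \<circ> \<phi> = \<plusminus> r i\<close>. In the identity of the Gram matrices against \<open>e\<^sub>i\<close> the rows
  above \<open>i\<close> vanish by triangularity and those below cancel by induction from the last row upwards.
\<close>

lemma row_sign:
  assumes tri: triangular and "i \<in> {1..6}"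
  obtains \<epsilon> :: real where "\<epsilon> \<in> {1, -1}" "\<And>x. (\<sigma> *v \<phi> x) $ of_nat i = \<epsilon> * (\<sigma> *v x) $ of_nat i"
proof -
  define r where "r i x = (\<sigma> *v x) $ of_nat i" for i x
  have gram: "(\<Sum>k = 1..6. r k (\<phi> x) * r k (\<phi> y)) = (\<Sum>k = 1..6. r k x * r k y)" for x y
    using isometry[of x y] by (simp add: r_def inner_vec_def sum_positions)
  have "\<exists>\<epsilon>\<in>{1, -1}. \<forall>x. r i (\<phi> x) = \<epsilon> * r i x" if "i \<in> {1..6}" for i
    using that
  proof (induction "6 - i" arbitrary: i rule: less_induct)
    case less
    let ?e = "std_basis i"
    have e: "?e \<in> coord {i..6}" "\<phi> ?e \<in> coord {i..6}"
      using less.prems tri by (auto intro: std_basis_in_coord triangular_column)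
    have low: "r k ?e = 0 \<and> r k (\<phi> ?e) = 0" if "k < i" "1 \<le> k" for k
    proof -
      have "coord {i..6} \<subseteq> coord {Suc k..6}"
        using that by (auto simp: coord_def)
      with e that less.prems show ?thesis
        by (auto simp: r_def intro!: row_Sigma_mats_zero[OF sigma])
    qed
    have high: "r k (\<phi> x) * r k (\<phi> ?e) = r k x * r k ?e" if "i < k" "k \<le> 6" for k x
    proof -
      have "6 - k < 6 - i" "k \<in> {1..6}"
        using that less.prems by auto
      from less.hyps[OF this] show ?thesis by auto
    qed
    have key: "r i (\<phi> x) * r i (\<phi> ?e) = r i x * r i ?e" for x
    proof -
      have "(\<Sum>k \<in> {1..6} - {i}. r k (\<phi> x) * r k (\<phi> ?e)) = (\<Sum>k \<in> {1..6} - {i}. r k x * r k ?e)"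
      proof (intro sum.cong refl)
        fix k assume "k \<in> {1..6} - {i}"
        then consider "k < i" "1 \<le> k" | "i < k" "k \<le> 6" by fastforce
        then show "r k (\<phi> x) * r k (\<phi> ?e) = r k x * r k ?e"
          by cases (simp_all add: low high)
      qed
      with gram[of x ?e] less.prems show ?thesis
        by (simp add: sum.remove[of "{1..6}" i])
    qed
    have pos: "r i ?e > 0"
      using row_Sigma_mats_leading[OF sigma less.prems e(1)] Sigma_mats_diag_pos[OF sigma less.prems]
        less.prems by (simp add: r_def std_basis_nth)
    from key[of ?e] have "r i (\<phi> ?e) = r i ?e \<or> r i (\<phi> ?e) = - r i ?e"
      by (simp add: square_eq_iff)
    then obtain \<epsilon> where \<epsilon>: "\<epsilon> \<in> {1, -1}" "r i (\<phi> ?e) = \<epsilon> * r i ?e"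
      by (cases "r i (\<phi> ?e) = r i ?e") (auto intro: that[of 1] that[of "-1"])
    have "r i (\<phi> x) = \<epsilon> * r i x" for x
    proof -
      have "r i ?e * r i (\<phi> x) = r i ?e * (\<epsilon> * r i x)"
        using key[of x] \<epsilon> by auto
      with pos show ?thesis by simp
    qed
    with \<epsilon>(1) show ?case by blast
  qed
  with assms(2) that show ?thesis
    unfolding r_def by blast
qed

lemma line_coord: "j \<in> {1..6} \<Longrightarrow> x \<in> coord {j} \<Longrightarrow> x = x $ of_nat j *\<^sub>R std_basis j"
  by (auto simp: vec_eq_iff all_positions coord_def std_basis_nth)

lemma triangular_diagonal:
  assumes tri: triangular and j: "j \<in> {1..6}"
  shows "\<phi> (std_basis j) $ of_nat j \<in> {1, -1}"
proof -
  let ?e = "std_basis j"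
  obtain \<epsilon> where \<epsilon>: "\<epsilon> \<in> {1, -1}" "\<And>x. (\<sigma> *v \<phi> x) $ of_nat j = \<epsilon> * (\<sigma> *v x) $ of_nat j"
    using row_sign[OF tri j] by blast
  have "?e \<in> coord {j..6}"
    using j by (auto intro: std_basis_in_coord)
  with \<epsilon>(2)[of ?e] triangular_column[OF tri j] have "\<phi> ?e $ of_nat j = \<epsilon>"
    using Sigma_mats_diag_pos[OF sigma j] j
    by (simp add: row_Sigma_mats_leading[OF sigma] std_basis_nth)
  with \<epsilon>(1) show ?thesis by simp
qed

lemma triangular_diagonal_nonzero:
  "triangular \<Longrightarrow> j \<in> {1..6} \<Longrightarrow> \<phi> (std_basis j) $ of_nat j \<noteq> 0"
  using triangular_diagonal by fastforce

lemma diagonal_sign: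
  assumes tri: triangular and j: "j \<in> {1..6}" and "\<phi> (std_basis j) \<in> coord {j}"
  shows "\<exists>\<epsilon>\<in>{1, -1}. \<phi> (std_basis j) = \<epsilon> *\<^sub>R std_basis j"
  using triangular_diagonal[OF tri j] line_coord[OF j assms(3)] by auto

text \<open>
  Row \<open>i\<close> of \<open>\<sigma> \<phi> = \<epsilon> \<sigma>\<close> in column \<open>j\<close>, where \<open>\<sigma>\<close> has a zero: if the entries of \<open>\<phi>\<close> between \<open>j\<close> and \<open>i\<close>
  vanish, only the term \<open>\<sigma>\<^sub>i\<^sub>i \<phi>\<^sub>i\<^sub>j\<close> survives on the left.
\<close>

lemma column_entry_zero:
  assumes tri: triangular and j: "j \<in> {1..6}" and "j < i" "i \<in> {1..6}"
    and "\<forall>k\<in>{1..6}. j < k \<and> k \<le> i \<and> 10 * k + j \<in> F \<longrightarrow> \<phi> (std_basis j) $ of_nat k = 0"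
  shows "\<phi> (std_basis j) $ of_nat i = 0"
  using assms(3-)
proof (induction i rule: less_induct)
  case (less i)
  show ?case
  proof (cases "10 * i + j \<in> F")
    case True
    with less.prems show ?thesis by auto
  next
    case False
    with sigma j less.prems have s0: "\<sigma> $ of_nat i $ of_nat j = 0"
      by (auto simp: Sigma_mats_def Let_def)
    obtain \<epsilon> where \<epsilon>: "(\<sigma> *v \<phi> (std_basis j)) $ of_nat i = \<epsilon> * (\<sigma> *v (std_basis j)) $ of_nat i"
      using row_sign[OF tri less.prems(2)] by blast
    have "(\<sigma> *v (std_basis j)) $ of_nat i = 0"
      unfolding row_Sigma_mats[OF sigma less.prems(2)]
      using j less.prems s0 by (intro sum.neutral) (auto simp: std_basis_nth)
    with \<epsilon> have "0 = (\<Sum>k = 1..i. \<sigma> $ of_nat i $ of_nat k * \<phi> (std_basis j) $ of_nat k)"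
      by (simp add: row_Sigma_mats[OF sigma less.prems(2)])
    also have "\<dots> = (\<Sum>k \<in> {i}. \<sigma> $ of_nat i $ of_nat k * \<phi> (std_basis j) $ of_nat k)"
    proof (intro sum.mono_neutral_right ballI)
      fix k assume k: "k \<in> {1..i} - {i}"
      then consider "k < j" | "k = j" | "j < k" "k < i" by fastforce
      then show "\<sigma> $ of_nat i $ of_nat k * \<phi> (std_basis j) $ of_nat k = 0"
      proof cases
        case 1
        with triangular_column[OF tri j] j k show ?thesis by (auto simp: coord_def)
      next
        case 2
        with s0 show ?thesis by simp
      next
        case 3
        with less.IH[of k] less.prems show ?thesis by auto
      qed
    qed (use less.prems in auto)
    finally show ?thesis
      using Sigma_mats_diag_pos[OF sigma less.prems(2)] by simp
  qed
qed

text \<open>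
  This is where the slice \<open>\<Sigma>(F)\<close> enters: invariance of the line of \<open>e\<^sub>j\<close> is a condition on the free
  positions of column \<open>j\<close> only.
\<close>

lemma stable_line_of_column:
  assumes tri: triangular and j: "j \<in> {1..6}"
    and free: "\<forall>i\<in>{1..6}. j < i \<and> 10 * i + j \<in> F \<longrightarrow> \<phi> (std_basis j) $ of_nat i = 0"
  shows "stable {j}"
proof -
  let ?e = "std_basis j"
  have "\<phi> ?e $ of_nat i = 0" if "j < i" "i \<in> {1..6}" for i
    using that free by (intro column_entry_zero[OF tri j]) auto
  then have "\<phi> ?e \<in> coord {j}"
    using triangular_column[OF tri j] unfolding coord_def
    by (auto simp: not_le)
  then obtain \<epsilon> where \<epsilon>: "\<epsilon> \<in> {1, -1}" "\<phi> ?e = \<epsilon> *\<^sub>R ?e"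
    using diagonal_sign[OF tri j] by blast
  have "coord {j} = span {?e}"
    using coord_as_span[of "{j}"] j by simp
  moreover have "\<phi> ` span {?e} = span {?e}"
  proof -
    have "span {\<epsilon> *\<^sub>R ?e} = span {?e}"
      using \<epsilon>(1) span_image_scale[of "{?e}" "\<lambda>_. \<epsilon>"] by auto
    then show ?thesis
      using linear_span_image[OF linear, of "{?e}"] \<epsilon>(2) by simp
  qed
  ultimately show ?thesis
    by (simp add: stable_image)
qed

lemma stable_line:
  assumes tri: triangular and "stable S" "j \<in> S" "j \<in> {1..6}" "\<forall>i\<in>S. j < i \<longrightarrow> 10 * i + j \<notin> F"
  shows "stable {j}"
proof (rule stable_line_of_column[OF tri assms(4)])
  show "\<forall>i\<in>{1..6}. j < i \<and> 10 * i + j \<in> F \<longrightarrow> \<phi> (std_basis j) $ of_nat i = 0"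
    using stable_image_in[OF assms(2-4)] assms(5) by (auto simp: coord_def)
qed

definition sign_diagonal :: bool where
  "sign_diagonal \<longleftrightarrow> (\<forall>k\<in>{1..6}. \<exists>\<epsilon>\<in>{1, -1}. \<phi> (std_basis k) = \<epsilon> *\<^sub>R std_basis k)"

lemma diagonal_from_generators:
  assumes tri: triangular and gens: "\<forall>j\<in>G. stable {j}"
    and gen: "\<forall>k\<in>{1..6}. k \<in> G \<or> (\<exists>i\<in>{1..6}. \<exists>j\<in>{1..6}. i < k \<and> j < k \<and>
      (tuple_bracket T (std_basis i) (std_basis j) = - std_basis k \<or>
       tuple_bracket T (std_basis i) (std_basis j) = std_basis k))"
  shows sign_diagonal
  unfolding sign_diagonal_def
proof
  fix k :: nat assume "k \<in> {1..6}"
  then show "\<exists>\<epsilon>\<in>{1, -1}. \<phi> (std_basis k) = \<epsilon> *\<^sub>R std_basis k"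
  proof (induction k rule: less_induct)
    case (less k)
    show ?case
    proof (cases "k \<in> G")
      case True
      with gens have "\<phi> (std_basis k) \<in> coord {k}"
        using less.prems by (simp add: stable_def std_basis_in_coord)
      with less.prems show ?thesis
        by (intro diagonal_sign[OF tri])
    next
      case False
      with gen less.prems obtain i j where ij: "i \<in> {1..6}" "j \<in> {1..6}" "i < k" "j < k"
        and b: "tuple_bracket T (std_basis i) (std_basis j) = - std_basis k \<or>
          tuple_bracket T (std_basis i) (std_basis j) = std_basis k" by blast
      then obtain s :: real where s: "std_basis k = s *\<^sub>R tuple_bracket T (std_basis i) (std_basis j)"
        by (elim disjE) (auto intro: that[of 1] that[of "-1"])
      obtain c d where cd: "c \<in> {1, -1}" "\<phi> (std_basis i) = c *\<^sub>R std_basis i"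
        "d \<in> {1, -1}" "\<phi> (std_basis j) = d *\<^sub>R std_basis j"
        using less.IH[OF ij(3,1)] less.IH[OF ij(4,2)] by blast
      have "\<phi> (std_basis k) = (c * d) *\<^sub>R std_basis k"
        by (simp add: s linear_scale[OF linear] hom cd(2,4) linear_scale[OF linear_tuple_bracket]
            linear_scale[OF linear_tuple_bracket_left] mult.left_commute)
      moreover have "c * d \<in> {1, -1}"
        using cd(1,3) by auto
      ultimately show ?thesis by blast
    qed
  qed
qed

section \<open>The algebras of the list\<close>

text \<open>
  Invariant coordinate subspaces are named by their positions: \<open>s456\<close> is invariance of
  \<open>span {e\<^sub>4, e\<^sub>5, e\<^sub>6}\<close>. The set \<open>F\<close> matters only after the flag is complete, because the comparison of
  \<open>\<sigma> \<phi>\<close> with \<open>\<sigma>\<close> needs triangularity. Subspaces outside the flag, such as \<open>s46\<close> or \<open>s1346\<close>, help to build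
  the flag or to clear a free position in the column of a generator.
\<close>

lemma sign_diagonal_h9:
  assumes T: "T = [[], [], [], [], [12], [51, 23]]"
    and F: "F = {33, 53, 54, 55, 65, 66}"
  shows sign_diagonal
proof -
  have s56: "stable {5, 6}"
    by (rule stable_bracket[OF stable_all stable_all]) (simp_all add: T coordinate_simps)
  have s23456: "stable {2, 3, 4, 5, 6}"
    by (rule stable_transporter[OF s56 stable_zero]) (auto simp: T coordinate_simps)
  have s46: "stable {4, 6}"
    by (rule stable_transporter[OF stable_all stable_zero]) (auto simp: T coordinate_simps)
  have s3456: "stable {3, 4, 5, 6}"
    by (rule stable_transporter[OF stable_all s46]) (auto simp: T coordinate_simps)
  have s456: "stable {4, 5, 6}"
    using stable_Un[OF s56 s46] by (simp add: insert_commute)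
  have s6: "stable {6}"
    by (rule stable_bracket[OF stable_all s56]) (simp_all add: T coordinate_simps)
  note tri = triangularI[OF s23456 s3456 s456 s56 s6]
  have s1: "stable {1}"
    by (rule stable_line[OF tri stable_all]) (simp_all add: F)
  have s2: "stable {2}"
    by (rule stable_line[OF tri stable_all]) (simp_all add: F)
  have s4: "stable {4}"
    by (rule stable_line[OF tri s46]) (simp_all add: F)
  have s1346: "stable {1, 3, 4, 6}"
    by (rule stable_transporter[OF s1 stable_zero]) (auto simp: T coordinate_simps)
  have s3: "stable {3}"
    by (rule stable_line[OF tri s1346]) (simp_all add: F)
  show ?thesis
    by (rule diagonal_from_generators[OF tri, of "{1, 2, 3, 4}"])
      (simp_all add: s1 s2 s3 s4 T positions coordinate_simps)
qed

lemma sign_diagonal_h10: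
  assumes T: "T = [[], [], [], [12], [13], [14]]"
    and F: "F = {44, 54, 55, 64, 65, 66}"
  shows sign_diagonal
proof -
  have s456: "stable {4, 5, 6}"
    by (rule stable_bracket[OF stable_all stable_all]) (simp_all add: T coordinate_simps)
  have s23456: "stable {2, 3, 4, 5, 6}"
    by (rule stable_transporter[OF s456 stable_zero]) (auto simp: T coordinate_simps)
  have s56: "stable {5, 6}"
    by (rule stable_transporter[OF stable_all stable_zero]) (auto simp: T coordinate_simps)
  have s3456: "stable {3, 4, 5, 6}"
    by (rule stable_transporter[OF stable_all s56]) (auto simp: T coordinate_simps)
  have s6: "stable {6}"
    by (rule stable_bracket[OF stable_all s456]) (simp_all add: T coordinate_simps)
  note tri = triangularI[OF s23456 s3456 s456 s56 s6]
  have s1: "stable {1}"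
    by (rule stable_line[OF tri stable_all]) (simp_all add: F)
  have s2: "stable {2}"
    by (rule stable_line[OF tri stable_all]) (simp_all add: F)
  have s3: "stable {3}"
    by (rule stable_line[OF tri stable_all]) (simp_all add: F)
  show ?thesis
    by (rule diagonal_from_generators[OF tri, of "{1, 2, 3}"])
      (simp_all add: s1 s2 s3 T positions coordinate_simps)
qed

lemma sign_diagonal_h11:
  assumes T: "T = [[], [], [], [12], [13], [14, 23]]"
    and F: "F = {33, 44, 54, 55, 64, 65, 66}"
  shows sign_diagonal
proof -
  have s456: "stable {4, 5, 6}"
    by (rule stable_bracket[OF stable_all stable_all]) (simp_all add: T coordinate_simps)
  have s23456: "stable {2, 3, 4, 5, 6}"
    by (rule stable_transporter[OF s456 stable_zero]) (auto simp: T coordinate_simps)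
  have s56: "stable {5, 6}"
    by (rule stable_transporter[OF stable_all stable_zero]) (auto simp: T coordinate_simps)
  have s3456: "stable {3, 4, 5, 6}"
    by (rule stable_transporter[OF stable_all s56]) (auto simp: T coordinate_simps)
  have s6: "stable {6}"
    by (rule stable_bracket[OF stable_all s456]) (simp_all add: T coordinate_simps)
  note tri = triangularI[OF s23456 s3456 s456 s56 s6]
  have s1: "stable {1}"
    by (rule stable_line[OF tri stable_all]) (simp_all add: F)
  have s2: "stable {2}"
    by (rule stable_line[OF tri stable_all]) (simp_all add: F)
  have s3: "stable {3}"
    by (rule stable_line[OF tri stable_all]) (simp_all add: F)
  show ?thesis
    by (rule diagonal_from_generators[OF tri, of "{1, 2, 3}"])
      (simp_all add: s1 s2 s3 T positions coordinate_simps)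
qed

text \<open>
  Both \<open>span {e\<^sub>2, ..., e\<^sub>6}\<close> and \<open>span {e\<^sub>1, e\<^sub>3, ..., e\<^sub>6}\<close> are transporters here, so the
  lines of \<open>e\<^sub>1\<close> and \<open>e\<^sub>2\<close> are invariant although position 21 of \<open>\<sigma>\<close> is free.
\<close>

lemma sign_diagonal_h12:
  assumes T: "T = [[], [], [], [12], [13], [24]]"
    and F: "F = {21, 43, 44, 54, 55, 64, 65, 66}"
  shows sign_diagonal
proof -
  have s56: "stable {5, 6}"
    by (rule stable_transporter[OF stable_all stable_zero]) (auto simp: T coordinate_simps)
  have s3456: "stable {3, 4, 5, 6}"
    by (rule stable_transporter[OF stable_all s56]) (auto simp: T coordinate_simps)
  have s456: "stable {4, 5, 6}"
    by (rule stable_bracket[OF stable_all stable_all]) (simp_all add: T coordinate_simps)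
  have s6: "stable {6}"
    by (rule stable_bracket[OF stable_all s456]) (simp_all add: T coordinate_simps)
  have s23456: "stable {2, 3, 4, 5, 6}"
    by (rule stable_transporter[OF s3456 s6]) (auto simp: T coordinate_simps)
  have s13456: "stable {1, 3, 4, 5, 6}"
    by (rule stable_transporter[OF s456 stable_zero]) (auto simp: T coordinate_simps)
  note tri = triangularI[OF s23456 s3456 s456 s56 s6]
  have s1: "stable {1}"
    by (rule stable_line[OF tri s13456]) (simp_all add: F)
  have s2: "stable {2}"
    by (rule stable_line[OF tri stable_all]) (simp_all add: F)
  have s5: "stable {5}"
    by (rule stable_bracket[OF s3456 s13456]) (simp_all add: T coordinate_simps)
  have s356: "stable {3, 5, 6}"
    by (rule stable_transporter[OF stable_all s5]) (auto simp: T coordinate_simps)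
  have s3: "stable {3}"
    by (rule stable_line[OF tri s356]) (simp_all add: F)
  show ?thesis
    by (rule diagonal_from_generators[OF tri, of "{1, 2, 3}"])
      (simp_all add: s1 s2 s3 T positions coordinate_simps)
qed

text \<open>
  Transporters and brackets do not separate \<open>e\<^sub>3\<close> from \<open>e\<^sub>4\<close>. But inside \<open>span {e\<^sub>3, ..., e\<^sub>6}\<close> a vector
  with a component along \<open>e\<^sub>4\<close> has a centralizer contained in that subspace,
  whereas a vector without one commutes with \<open>e\<^sub>2\<close>; this characterizes \<open>span {e\<^sub>3, e\<^sub>5, e\<^sub>6}\<close>.
\<close>

lemma sign_diagonal_h14:
  assumes T: "T = [[], [], [], [12], [14], [13, 42]]"
    and F: "F = {33, 43, 44, 54, 55, 64, 65, 66}"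
  shows sign_diagonal
proof -
  have s56: "stable {5, 6}"
    by (rule stable_transporter[OF stable_all stable_zero]) (auto simp: T coordinate_simps)
  have s3456: "stable {3, 4, 5, 6}"
    by (rule stable_transporter[OF stable_all s56]) (auto simp: T coordinate_simps)
  have s356: "stable {3, 5, 6}"
  proof (rule stable_noncentralized[OF s3456])
    fix x
    show "x \<in> coord {3, 5, 6} \<longleftrightarrow>
        x \<in> coord {3, 4, 5, 6} \<and> (\<exists>y. y \<notin> coord {3, 4, 5, 6} \<and> tuple_bracket T x y = 0)"
      (is "?l \<longleftrightarrow> ?r")
    proof
      assume ?l
      then have "x \<in> coord {3, 4, 5, 6}" "std_basis 2 \<notin> coord {3, 4, 5, 6}"
        "tuple_bracket T x (std_basis 2) = 0"
        by (simp_all add: T coordinate_simps)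
      then show ?r by blast
    next
      assume ?r
      then show ?l
        by (auto simp: T coordinate_simps)
    qed
  qed
  have s23456: "stable {2, 3, 4, 5, 6}"
    by (rule stable_transporter[OF s356 stable_zero]) (auto simp: T coordinate_simps)
  have s456: "stable {4, 5, 6}"
    by (rule stable_bracket[OF stable_all stable_all]) (simp_all add: T coordinate_simps)
  have s6: "stable {6}"
    by (rule stable_bracket[OF stable_all s356]) (simp_all add: T coordinate_simps)
  note tri = triangularI[OF s23456 s3456 s456 s56 s6]
  have s1: "stable {1}"
    by (rule stable_line[OF tri stable_all]) (simp_all add: F)
  have s2: "stable {2}"
    by (rule stable_line[OF tri stable_all]) (simp_all add: F)
  have s3: "stable {3}"
    by (rule stable_line[OF tri s356]) (simp_all add: F)
  show ?thesis
    by (rule diagonal_from_generators[OF tri, of "{1, 2, 3}"])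
      (simp_all add: s1 s2 s3 T positions coordinate_simps)
qed

lemma sign_diagonal_h18:
  assumes T: "T = [[], [], [], [12], [13], [15, 24]]"
    and F: "F = {32, 33, 43, 44, 54, 55, 64, 65, 66}"
  shows sign_diagonal
proof -
  have s456: "stable {4, 5, 6}"
    by (rule stable_bracket[OF stable_all stable_all]) (simp_all add: T coordinate_simps)
  have s3456: "stable {3, 4, 5, 6}"
    by (rule stable_transporter[OF s456 stable_zero]) (auto simp: T coordinate_simps)
  have s6: "stable {6}"
    by (rule stable_transporter[OF stable_all stable_zero]) (auto simp: T coordinate_simps)
  have s23456: "stable {2, 3, 4, 5, 6}"
    by (rule stable_transporter[OF s3456 s6]) (auto simp: T coordinate_simps)
  have s56: "stable {5, 6}"
    by (rule stable_bracket[OF stable_all s3456]) (simp_all add: T coordinate_simps)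
  note tri = triangularI[OF s23456 s3456 s456 s56 s6]
  have s1: "stable {1}"
    by (rule stable_line[OF tri stable_all]) (simp_all add: F)
  have s146: "stable {1, 4, 6}"
    by (rule stable_transporter[OF s1 stable_zero]) (auto simp: T coordinate_simps)
  have s2456: "stable {2, 4, 5, 6}"
    by (rule stable_transporter[OF stable_all s146]) (auto simp: T coordinate_simps)
  have s2: "stable {2}"
    by (rule stable_line[OF tri s2456]) (simp_all add: F)
  have s356: "stable {3, 5, 6}"
    by (rule stable_transporter[OF s23456 stable_zero]) (auto simp: T coordinate_simps)
  have s3: "stable {3}"
    by (rule stable_line[OF tri s356]) (simp_all add: F)
  show ?thesis
    by (rule diagonal_from_generators[OF tri, of "{1, 2, 3}"])
      (simp_all add: s1 s2 s3 T positions coordinate_simps)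
qed

lemma sign_diagonal_h21:
  assumes T: "T = [[], [], [], [12], [14], [15]]"
    and F: "F = {43, 44, 53, 54, 55, 64, 65, 66}"
  shows sign_diagonal
proof -
  have s456: "stable {4, 5, 6}"
    by (rule stable_bracket[OF stable_all stable_all]) (simp_all add: T coordinate_simps)
  have s23456: "stable {2, 3, 4, 5, 6}"
    by (rule stable_transporter[OF s456 stable_zero]) (auto simp: T coordinate_simps)
  have s36: "stable {3, 6}"
    by (rule stable_transporter[OF stable_all stable_zero]) (auto simp: T coordinate_simps)
  have s3456: "stable {3, 4, 5, 6}"
    using stable_Un[OF s456 s36] by (simp add: insert_commute)
  have s56: "stable {5, 6}"
    by (rule stable_bracket[OF stable_all s456]) (simp_all add: T coordinate_simps)
  have s6: "stable {6}"
    using stable_Int[OF s456 s36] by simp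
  note tri = triangularI[OF s23456 s3456 s456 s56 s6]
  have s1: "stable {1}"
    by (rule stable_line[OF tri stable_all]) (simp_all add: F)
  have s2: "stable {2}"
    by (rule stable_line[OF tri stable_all]) (simp_all add: F)
  have s3: "stable {3}"
    by (rule stable_line[OF tri s36]) (simp_all add: F)
  show ?thesis
    by (rule diagonal_from_generators[OF tri, of "{1, 2, 3}"])
      (simp_all add: s1 s2 s3 T positions coordinate_simps)
qed

lemma sign_diagonal_h22:
  assumes T: "T = [[], [], [], [12], [14], [15, 24]]"
    and F: "F = {22, 43, 44, 53, 54, 55, 64, 65, 66}"
  shows sign_diagonal
proof -
  have s456: "stable {4, 5, 6}"
    by (rule stable_bracket[OF stable_all stable_all]) (simp_all add: T coordinate_simps)
  have s36: "stable {3, 6}"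
    by (rule stable_transporter[OF stable_all stable_zero]) (auto simp: T coordinate_simps)
  have s23456: "stable {2, 3, 4, 5, 6}"
    by (rule stable_transporter[OF s456 s36]) (auto simp: T coordinate_simps)
  have s3456: "stable {3, 4, 5, 6}"
    by (rule stable_transporter[OF s456 stable_zero]) (auto simp: T coordinate_simps)
  have s56: "stable {5, 6}"
    by (rule stable_bracket[OF stable_all s456]) (simp_all add: T coordinate_simps)
  have s6: "stable {6}"
    using stable_Int[OF s456 s36] by simp
  note tri = triangularI[OF s23456 s3456 s456 s56 s6]
  have s1: "stable {1}"
    by (rule stable_line[OF tri stable_all]) (simp_all add: F)
  have s2: "stable {2}"
    by (rule stable_line[OF tri stable_all]) (simp_all add: F)
  have s3: "stable {3}"
    by (rule stable_line[OF tri s36]) (simp_all add: F)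
  show ?thesis
    by (rule diagonal_from_generators[OF tri, of "{1, 2, 3}"])
      (simp_all add: s1 s2 s3 T positions coordinate_simps)
qed

lemma sign_diagonal_h23:
  assumes T: "T = [[], [], [12], [13], [23], [14]]"
    and F: "F = {33, 43, 44, 53, 54, 55, 63, 64, 65, 66}"
  shows sign_diagonal
proof -
  have s3456: "stable {3, 4, 5, 6}"
    by (rule stable_bracket[OF stable_all stable_all]) (simp_all add: T coordinate_simps)
  have s56: "stable {5, 6}"
    by (rule stable_transporter[OF stable_all stable_zero]) (auto simp: T coordinate_simps)
  have s23456: "stable {2, 3, 4, 5, 6}"
    by (rule stable_transporter[OF s3456 s56]) (auto simp: T coordinate_simps)
  have s456: "stable {4, 5, 6}"
    by (rule stable_bracket[OF stable_all s3456]) (simp_all add: T coordinate_simps)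
  have s6: "stable {6}"
    by (rule stable_bracket[OF stable_all s456]) (simp_all add: T coordinate_simps)
  note tri = triangularI[OF s23456 s3456 s456 s56 s6]
  have s1: "stable {1}"
    by (rule stable_line[OF tri stable_all]) (simp_all add: F)
  have s2: "stable {2}"
    by (rule stable_line[OF tri stable_all]) (simp_all add: F)
  show ?thesis
    by (rule diagonal_from_generators[OF tri, of "{1, 2}"])
      (simp_all add: s1 s2 T positions coordinate_simps)
qed

lemma sign_diagonal_h24:
  assumes T: "T = [[], [], [], [12], [14], [15, 23, 24]]"
    and F: "F = {22, 33, 43, 44, 53, 54, 55, 64, 65, 66}"
  shows sign_diagonal
proof -
  have s456: "stable {4, 5, 6}"
    by (rule stable_bracket[OF stable_all stable_all]) (simp_all add: T coordinate_simps)
  have s6: "stable {6}"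
    by (rule stable_transporter[OF stable_all stable_zero]) (auto simp: T coordinate_simps)
  have s23456: "stable {2, 3, 4, 5, 6}"
    by (rule stable_transporter[OF s456 s6]) (auto simp: T coordinate_simps)
  have s3456: "stable {3, 4, 5, 6}"
    by (rule stable_transporter[OF s456 stable_zero]) (auto simp: T coordinate_simps)
  have s56: "stable {5, 6}"
    by (rule stable_bracket[OF stable_all s456]) (simp_all add: T coordinate_simps)
  note tri = triangularI[OF s23456 s3456 s456 s56 s6]
  have s1: "stable {1}"
    by (rule stable_line[OF tri stable_all]) (simp_all add: F)
  have s2: "stable {2}"
    by (rule stable_line[OF tri stable_all]) (simp_all add: F)
  have s136: "stable {1, 3, 6}"
    by (rule stable_transporter[OF s1 stable_zero]) (auto simp: T coordinate_simps)
  have s3: "stable {3}"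
    by (rule stable_line[OF tri s136]) (simp_all add: F)
  show ?thesis
    by (rule diagonal_from_generators[OF tri, of "{1, 2, 3}"])
      (simp_all add: s1 s2 s3 T positions coordinate_simps)
qed

lemma sign_diagonal_h25:
  assumes T: "T = [[], [], [], [12], [14], [15, 23]]"
    and F: "F = {33, 43, 44, 53, 54, 55, 64, 65, 66}"
  shows sign_diagonal
proof -
  have s456: "stable {4, 5, 6}"
    by (rule stable_bracket[OF stable_all stable_all]) (simp_all add: T coordinate_simps)
  have s23456: "stable {2, 3, 4, 5, 6}"
    by (rule stable_transporter[OF s456 stable_zero]) (auto simp: T coordinate_simps)
  have s56: "stable {5, 6}"
    by (rule stable_bracket[OF stable_all s456]) (simp_all add: T coordinate_simps)
  have s3456: "stable {3, 4, 5, 6}"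
    by (rule stable_transporter[OF stable_all s56]) (auto simp: T coordinate_simps)
  have s6: "stable {6}"
    by (rule stable_transporter[OF stable_all stable_zero]) (auto simp: T coordinate_simps)
  note tri = triangularI[OF s23456 s3456 s456 s56 s6]
  have s1: "stable {1}"
    by (rule stable_line[OF tri stable_all]) (simp_all add: F)
  have s2: "stable {2}"
    by (rule stable_line[OF tri stable_all]) (simp_all add: F)
  have s136: "stable {1, 3, 6}"
    by (rule stable_transporter[OF s1 stable_zero]) (auto simp: T coordinate_simps)
  have s3: "stable {3}"
    by (rule stable_line[OF tri s136]) (simp_all add: F)
  show ?thesis
    by (rule diagonal_from_generators[OF tri, of "{1, 2, 3}"])
      (simp_all add: s1 s2 s3 T positions coordinate_simps)
qed

text \<open>
  The entry \<open>c = \<phi>\<^sub>3\<^sub>1\<close> survives the invariant subspaces. It vanishes on comparing the \<open>e\<^sub>6\<close>-component in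
  \<open>\<phi> e\<^sub>5 = - [\<phi> e\<^sub>1, \<phi> e\<^sub>4] = [\<phi> e\<^sub>2, \<phi> e\<^sub>3]\<close>: the second bracket has none because \<open>\<phi> e\<^sub>2\<close> is a multiple
  of \<open>e\<^sub>2\<close>, and in the first one \<open>c\<close> contributes equally through \<open>[e\<^sub>1, e\<^sub>5]\<close> and \<open>[e\<^sub>3, e\<^sub>4]\<close>.
\<close>

lemma sign_diagonal_h27:
  assumes T: "T = [[], [], [], [12], [14, -23], [15, 34]]"
    and F: "F = {31, 32, 33, 43, 44, 53, 54, 55, 64, 65, 66}"
  shows sign_diagonal
proof -
  have s456: "stable {4, 5, 6}"
    by (rule stable_bracket[OF stable_all stable_all]) (simp_all add: T coordinate_simps)
  have s6: "stable {6}"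
    by (rule stable_transporter[OF stable_all stable_zero]) (auto simp: T coordinate_simps)
  have s23456: "stable {2, 3, 4, 5, 6}"
    by (rule stable_transporter[OF s456 s6]) (auto simp: T coordinate_simps)
  have s56: "stable {5, 6}"
    by (rule stable_bracket[OF stable_all s456]) (simp_all add: T coordinate_simps)
  have s3456: "stable {3, 4, 5, 6}"
    by (rule stable_transporter[OF stable_all s56]) (auto simp: T coordinate_simps)
  have s2456: "stable {2, 4, 5, 6}"
    by (rule stable_transporter[OF s456 stable_zero]) (auto simp: T coordinate_simps)
  note tri = triangularI[OF s23456 s3456 s456 s56 s6]
  have s2: "stable {2}"
    by (rule stable_line[OF tri s2456]) (simp_all add: F)
  have zero: "\<phi> (std_basis 2) \<in> coord {2}" "\<phi> (std_basis 3) \<in> coord {3, 4, 5, 6}"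
    "\<phi> (std_basis 4) \<in> coord {4, 5, 6}"
    by (simp_all add: stable_image_in s2 s3456 s456)
  have b: "tuple_bracket T (\<phi> (std_basis 1)) (\<phi> (std_basis 2)) = - \<phi> (std_basis 4)"
    "tuple_bracket T (\<phi> (std_basis 1)) (\<phi> (std_basis 4)) = - \<phi> (std_basis 5)"
    by (rule bracket_neg; simp add: T coordinate_simps)+
  have b': "tuple_bracket T (\<phi> (std_basis 2)) (\<phi> (std_basis 3)) = \<phi> (std_basis 5)"
    unfolding hom[symmetric] by (rule arg_cong[of _ _ \<phi>]) (simp add: T coordinate_simps)
  define a c q where "a = \<phi> (std_basis 1) $ 1" and "c = \<phi> (std_basis 1) $ 3"
    and "q = \<phi> (std_basis 2) $ 2"
  have nonzero: "a \<noteq> 0" "q \<noteq> 0"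
    using triangular_diagonal_nonzero[OF tri, of 1] triangular_diagonal_nonzero[OF tri, of 2]
    by (simp_all add: a_def q_def)
  have "\<phi> (std_basis 4) $ 4 = a * q" "\<phi> (std_basis 4) $ 5 = c * q"
    using b(1) zero by (simp_all add: T coordinate_simps a_def c_def q_def)
  moreover have "\<phi> (std_basis 5) $ 6 = 0"
    using b' zero by (simp add: T coordinate_simps)
  moreover have "\<phi> (std_basis 5) $ 6 = a * \<phi> (std_basis 4) $ 5 + c * \<phi> (std_basis 4) $ 4"
    using b(2) zero by (simp add: T coordinate_simps a_def c_def)
  ultimately have "2 * (a * c * q) = 0"
    by (simp add: algebra_simps)
  then have "\<phi> (std_basis 1) $ 3 = 0"
    using nonzero by (simp add: c_def)
  then have s1: "stable {1}"
    by (intro stable_line_of_column[OF tri]) (simp_all add: F positions)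
  have s136: "stable {1, 3, 6}"
    by (rule stable_transporter[OF s1 stable_zero]) (auto simp: T coordinate_simps)
  have s3: "stable {3}"
    by (rule stable_line[OF tri s136]) (simp_all add: F)
  show ?thesis
    by (rule diagonal_from_generators[OF tri, of "{1, 2, 3}"])
      (simp_all add: s1 s2 s3 T positions coordinate_simps)
qed

lemma sign_diagonal_h28:
  assumes T: "T = [[], [], [12], [13], [14], [15]]"
    and F: "F = {33, 43, 44, 53, 54, 55, 63, 64, 65, 66}"
  shows sign_diagonal
proof -
  have s3456: "stable {3, 4, 5, 6}"
    by (rule stable_bracket[OF stable_all stable_all]) (simp_all add: T coordinate_simps)
  have s23456: "stable {2, 3, 4, 5, 6}"
    by (rule stable_transporter[OF s3456 stable_zero]) (auto simp: T coordinate_simps)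
  have s456: "stable {4, 5, 6}"
    by (rule stable_bracket[OF stable_all s3456]) (simp_all add: T coordinate_simps)
  have s6: "stable {6}"
    by (rule stable_transporter[OF stable_all stable_zero]) (auto simp: T coordinate_simps)
  have s56: "stable {5, 6}"
    by (rule stable_transporter[OF stable_all s6]) (auto simp: T coordinate_simps)
  note tri = triangularI[OF s23456 s3456 s456 s56 s6]
  have s1: "stable {1}"
    by (rule stable_line[OF tri stable_all]) (simp_all add: F)
  have s2: "stable {2}"
    by (rule stable_line[OF tri stable_all]) (simp_all add: F)
  show ?thesis
    by (rule diagonal_from_generators[OF tri, of "{1, 2}"])
      (simp_all add: s1 s2 T positions coordinate_simps)
qed

lemma sign_diagonal_h29:
  assumes T: "T = [[], [], [12], [13], [14], [23, 15]]"
    and F: "F = {22, 33, 43, 44, 53, 54, 55, 63, 64, 65, 66}"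
  shows sign_diagonal
proof -
  have s3456: "stable {3, 4, 5, 6}"
    by (rule stable_bracket[OF stable_all stable_all]) (simp_all add: T coordinate_simps)
  have s6: "stable {6}"
    by (rule stable_transporter[OF stable_all stable_zero]) (auto simp: T coordinate_simps)
  have s23456: "stable {2, 3, 4, 5, 6}"
    by (rule stable_transporter[OF s3456 s6]) (auto simp: T coordinate_simps)
  have s456: "stable {4, 5, 6}"
    by (rule stable_bracket[OF stable_all s3456]) (simp_all add: T coordinate_simps)
  have s56: "stable {5, 6}"
    by (rule stable_transporter[OF stable_all s6]) (auto simp: T coordinate_simps)
  note tri = triangularI[OF s23456 s3456 s456 s56 s6]
  have s1: "stable {1}"
    by (rule stable_line[OF tri stable_all]) (simp_all add: F)
  have s2: "stable {2}"
    by (rule stable_line[OF tri stable_all]) (simp_all add: F)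
  show ?thesis
    by (rule diagonal_from_generators[OF tri, of "{1, 2}"])
      (simp_all add: s1 s2 T positions coordinate_simps)
qed

text \<open>
  The entry \<open>c = \<phi>\<^sub>2\<^sub>1\<close> vanishes on comparing the \<open>e\<^sub>6\<close>-component in
  \<open>\<phi> e\<^sub>5 = - [\<phi> e\<^sub>1, \<phi> e\<^sub>4] = - [\<phi> e\<^sub>2, \<phi> e\<^sub>3]\<close>: in the first bracket \<open>c\<close> contributes equally through
  \<open>[e\<^sub>1, e\<^sub>5]\<close> and \<open>[e\<^sub>2, e\<^sub>4]\<close>, and the second one has no such component.
\<close>

lemma sign_diagonal_h30:
  assumes T: "T = [[], [], [12], [13], [14, 23], [24, 15]]"
    and F: "F = {21, 22, 33, 43, 44, 53, 54, 55, 63, 64, 65, 66}"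
  shows sign_diagonal
proof -
  have s3456: "stable {3, 4, 5, 6}"
    by (rule stable_bracket[OF stable_all stable_all]) (simp_all add: T coordinate_simps)
  have s6: "stable {6}"
    by (rule stable_transporter[OF stable_all stable_zero]) (auto simp: T coordinate_simps)
  have s56: "stable {5, 6}"
    by (rule stable_transporter[OF stable_all s6]) (auto simp: T coordinate_simps)
  have s23456: "stable {2, 3, 4, 5, 6}"
    by (rule stable_transporter[OF s3456 s56]) (auto simp: T coordinate_simps)
  have s456: "stable {4, 5, 6}"
    by (rule stable_bracket[OF stable_all s3456]) (simp_all add: T coordinate_simps)
  note tri = triangularI[OF s23456 s3456 s456 s56 s6]
  have s2: "stable {2}"
    by (rule stable_line[OF tri stable_all]) (simp_all add: F)
  have zero: "\<phi> (std_basis 2) \<in> coord {2}" "\<phi> (std_basis 3) \<in> coord {3, 4, 5, 6}"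
    "\<phi> (std_basis 4) \<in> coord {4, 5, 6}"
    by (simp_all add: stable_image_in s2 s3456 s456)
  have b: "tuple_bracket T (\<phi> (std_basis 1)) (\<phi> (std_basis 2)) = - \<phi> (std_basis 3)"
    "tuple_bracket T (\<phi> (std_basis 1)) (\<phi> (std_basis 3)) = - \<phi> (std_basis 4)"
    "tuple_bracket T (\<phi> (std_basis 1)) (\<phi> (std_basis 4)) = - \<phi> (std_basis 5)"
    "tuple_bracket T (\<phi> (std_basis 2)) (\<phi> (std_basis 3)) = - \<phi> (std_basis 5)"
    by (rule bracket_neg; simp add: T coordinate_simps)+
  define a c q where "a = \<phi> (std_basis 1) $ 1" and "c = \<phi> (std_basis 1) $ 2"
    and "q = \<phi> (std_basis 2) $ 2"
  have nonzero: "a \<noteq> 0" "q \<noteq> 0"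
    using triangular_diagonal_nonzero[OF tri, of 1] triangular_diagonal_nonzero[OF tri, of 2]
    by (simp_all add: a_def q_def)
  have e3: "\<phi> (std_basis 3) $ 3 = a * q" "\<phi> (std_basis 3) $ 4 = 0"
    using b(1) zero by (simp_all add: T coordinate_simps a_def q_def)
  have "\<phi> (std_basis 4) $ 4 = a * (a * q)" "\<phi> (std_basis 4) $ 5 = c * (a * q)"
    using b(2) zero e3 by (simp_all add: T coordinate_simps a_def c_def q_def)
  moreover have "\<phi> (std_basis 5) $ 6 = 0"
    using b(4) zero e3 by (simp add: T coordinate_simps)
  moreover have "\<phi> (std_basis 5) $ 6 = a * \<phi> (std_basis 4) $ 5 + c * \<phi> (std_basis 4) $ 4"
    using b(3) zero by (simp add: T coordinate_simps a_def c_def)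
  ultimately have "2 * (a * a * c * q) = 0"
    by (simp add: algebra_simps)
  then have "\<phi> (std_basis 1) $ 2 = 0"
    using nonzero by (simp add: c_def)
  then have s1: "stable {1}"
    by (intro stable_line_of_column[OF tri]) (simp_all add: F positions)
  show ?thesis
    by (rule diagonal_from_generators[OF tri, of "{1, 2}"])
      (simp_all add: s1 s2 T positions coordinate_simps)
qed

text \<open>
  The entry \<open>c = \<phi>\<^sub>4\<^sub>2\<close> vanishes because \<open>[e\<^sub>2, e\<^sub>3] = 0\<close>: since \<open>\<phi> e\<^sub>3 = - [\<phi> e\<^sub>1, \<phi> e\<^sub>2]\<close>, it contributes equally
  to the \<open>e\<^sub>6\<close>-component of \<open>[\<phi> e\<^sub>2, \<phi> e\<^sub>3]\<close> through \<open>[e\<^sub>4, e\<^sub>3]\<close> and \<open>[e\<^sub>2, e\<^sub>5]\<close>. The entry \<open>\<phi>\<^sub>3\<^sub>2\<close>, which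
  would enter quadratically, is zero since position 32 is not free.
\<close>

lemma sign_diagonal_h31:
  assumes T: "T = [[], [], [12], [13], [14], [34, 52]]"
    and F: "F = {21, 33, 42, 43, 44, 53, 54, 55, 63, 64, 65, 66}"
  shows sign_diagonal
proof -
  have s3456: "stable {3, 4, 5, 6}"
    by (rule stable_bracket[OF stable_all stable_all]) (simp_all add: T coordinate_simps)
  have s6: "stable {6}"
    by (rule stable_transporter[OF stable_all stable_zero]) (auto simp: T coordinate_simps)
  have s23456: "stable {2, 3, 4, 5, 6}"
    by (rule stable_transporter[OF s3456 s6]) (auto simp: T coordinate_simps)
  have s456: "stable {4, 5, 6}"
    by (rule stable_bracket[OF stable_all s3456]) (simp_all add: T coordinate_simps)
  have s56: "stable {5, 6}"
    by (rule stable_transporter[OF stable_all s6]) (auto simp: T coordinate_simps)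
  have s13456: "stable {1, 3, 4, 5, 6}"
    by (rule stable_transporter[OF s56 stable_zero]) (auto simp: T coordinate_simps)
  note tri = triangularI[OF s23456 s3456 s456 s56 s6]
  have s1: "stable {1}"
    by (rule stable_line[OF tri s13456]) (simp_all add: F)
  have zero: "\<phi> (std_basis 1) \<in> coord {1}" "\<phi> (std_basis 2) \<in> coord {2, 3, 4, 5, 6}"
    "\<phi> (std_basis 3) \<in> coord {3, 4, 5, 6}"
    by (simp_all add: stable_image_in s1 s23456 s3456)
  have "\<phi> (std_basis 2) $ of_nat 3 = 0"
    by (rule column_entry_zero[OF tri]) (simp_all add: F positions)
  then have zero': "\<phi> (std_basis 2) $ 3 = 0"
    by simp
  have b: "tuple_bracket T (\<phi> (std_basis 1)) (\<phi> (std_basis 2)) = - \<phi> (std_basis 3)"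
    by (rule bracket_neg) (simp add: T coordinate_simps)
  have b': "tuple_bracket T (\<phi> (std_basis 2)) (\<phi> (std_basis 3)) = 0"
    unfolding hom[symmetric] phi_eq_0_iff by (simp add: T coordinate_simps)
  define p q c where "p = \<phi> (std_basis 1) $ 1" and "q = \<phi> (std_basis 2) $ 2"
    and "c = \<phi> (std_basis 2) $ 4"
  have nonzero: "p \<noteq> 0" "q \<noteq> 0"
    using triangular_diagonal_nonzero[OF tri, of 1] triangular_diagonal_nonzero[OF tri, of 2]
    by (simp_all add: p_def q_def)
  have e3: "\<phi> (std_basis 3) $ 3 = p * q" "\<phi> (std_basis 3) $ 4 = 0" "\<phi> (std_basis 3) $ 5 = p * c"
    using b zero zero' by (simp_all add: T coordinate_simps p_def q_def c_def)
  have "c * (p * q) + q * (p * c) = 0"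
    using b' zero zero' e3 by (simp add: T coordinate_simps q_def c_def)
  then have "2 * (c * p * q) = 0"
    by (simp add: algebra_simps)
  then have "\<phi> (std_basis 2) $ 4 = 0"
    using nonzero by (simp add: c_def)
  then have s2: "stable {2}"
    by (intro stable_line_of_column[OF tri]) (simp_all add: F positions)
  show ?thesis
    by (rule diagonal_from_generators[OF tri, of "{1, 2}"])
      (simp_all add: s1 s2 T positions coordinate_simps)
qed

text \<open>
  As for \<open>h\<^sub>3\<^sub>1\<close>, but now \<open>[e\<^sub>2, e\<^sub>3] = - e\<^sub>5\<close>. The \<open>e\<^sub>6\<close>-component of \<open>\<phi> e\<^sub>5\<close> is still zero since
  \<open>\<phi> e\<^sub>5 = - [\<phi> e\<^sub>1, \<phi> e\<^sub>4]\<close> and \<open>\<phi> e\<^sub>1\<close> is a multiple of \<open>e\<^sub>1\<close>.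
\<close>

lemma sign_diagonal_h32:
  assumes T: "T = [[], [], [12], [13], [14, 23], [34, 52]]"
    and F: "F = {21, 22, 33, 42, 43, 44, 53, 54, 55, 63, 64, 65, 66}"
  shows sign_diagonal
proof -
  have s3456: "stable {3, 4, 5, 6}"
    by (rule stable_bracket[OF stable_all stable_all]) (simp_all add: T coordinate_simps)
  have s6: "stable {6}"
    by (rule stable_transporter[OF stable_all stable_zero]) (auto simp: T coordinate_simps)
  have s56: "stable {5, 6}"
    by (rule stable_transporter[OF stable_all s6]) (auto simp: T coordinate_simps)
  have s23456: "stable {2, 3, 4, 5, 6}"
    by (rule stable_transporter[OF s3456 s56]) (auto simp: T coordinate_simps)
  have s456: "stable {4, 5, 6}"
    by (rule stable_bracket[OF stable_all s3456]) (simp_all add: T coordinate_simps)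
  have s13456: "stable {1, 3, 4, 5, 6}"
    by (rule stable_transporter[OF s56 stable_zero]) (auto simp: T coordinate_simps)
  note tri = triangularI[OF s23456 s3456 s456 s56 s6]
  have s1: "stable {1}"
    by (rule stable_line[OF tri s13456]) (simp_all add: F)
  have zero: "\<phi> (std_basis 1) \<in> coord {1}" "\<phi> (std_basis 2) \<in> coord {2, 3, 4, 5, 6}"
    "\<phi> (std_basis 3) \<in> coord {3, 4, 5, 6}" "\<phi> (std_basis 4) \<in> coord {4, 5, 6}"
    by (simp_all add: stable_image_in s1 s23456 s3456 s456)
  have "\<phi> (std_basis 2) $ of_nat 3 = 0"
    by (rule column_entry_zero[OF tri]) (simp_all add: F positions)
  then have zero': "\<phi> (std_basis 2) $ 3 = 0"
    by simp
  have b: "tuple_bracket T (\<phi> (std_basis 1)) (\<phi> (std_basis 2)) = - \<phi> (std_basis 3)"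
    "tuple_bracket T (\<phi> (std_basis 1)) (\<phi> (std_basis 4)) = - \<phi> (std_basis 5)"
    "tuple_bracket T (\<phi> (std_basis 2)) (\<phi> (std_basis 3)) = - \<phi> (std_basis 5)"
    by (rule bracket_neg; simp add: T coordinate_simps)+
  define p q c where "p = \<phi> (std_basis 1) $ 1" and "q = \<phi> (std_basis 2) $ 2"
    and "c = \<phi> (std_basis 2) $ 4"
  have nonzero: "p \<noteq> 0" "q \<noteq> 0"
    using triangular_diagonal_nonzero[OF tri, of 1] triangular_diagonal_nonzero[OF tri, of 2]
    by (simp_all add: p_def q_def)
  have e3: "\<phi> (std_basis 3) $ 3 = p * q" "\<phi> (std_basis 3) $ 4 = 0" "\<phi> (std_basis 3) $ 5 = p * c"
    using b(1) zero zero' by (simp_all add: T coordinate_simps p_def q_def c_def)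
  have "\<phi> (std_basis 5) $ 6 = 0"
    using b(2) zero by (simp add: T coordinate_simps)
  then have "c * (p * q) + q * (p * c) = 0"
    using b(3) zero zero' e3 by (simp add: T coordinate_simps q_def c_def)
  then have "2 * (c * p * q) = 0"
    by (simp add: algebra_simps)
  then have "\<phi> (std_basis 2) $ 4 = 0"
    using nonzero by (simp add: c_def)
  then have s2: "stable {2}"
    by (intro stable_line_of_column[OF tri]) (simp_all add: F positions)
  show ?thesis
    by (rule diagonal_from_generators[OF tri, of "{1, 2}"])
      (simp_all add: s1 s2 T positions coordinate_simps)
qed

lemma sign_diagonal_table: "(T, F) \<in> cslat_table \<Longrightarrow> sign_diagonal"
  unfolding cslat_table_def
  by (elim insertE emptyE; unfold prod.inject; elim conjE)
    (erule (1) sign_diagonal_h9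
       | erule (1) sign_diagonal_h10
       | erule (1) sign_diagonal_h11
       | erule (1) sign_diagonal_h12
       | erule (1) sign_diagonal_h14
       | erule (1) sign_diagonal_h18
       | erule (1) sign_diagonal_h21
       | erule (1) sign_diagonal_h22
       | erule (1) sign_diagonal_h23
       | erule (1) sign_diagonal_h24
       | erule (1) sign_diagonal_h25
       | erule (1) sign_diagonal_h27
       | erule (1) sign_diagonal_h28
       | erule (1) sign_diagonal_h29
       | erule (1) sign_diagonal_h30
       | erule (1) sign_diagonal_h31
       | erule (1) sign_diagonal_h32)+

end

section \<open>Isotropy groups\<close>

lemma metric_orthogonal_isometry:
  assumes "A \<in> metric_orthogonal_group (metric_mat \<sigma>)"
  shows "(\<sigma> *v (A *v x)) \<bullet> (\<sigma> *v (A *v y)) = (\<sigma> *v x) \<bullet> (\<sigma> *v y)"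
proof -
  have gram: "(B *v x) \<bullet> (B *v y) = x \<bullet> ((transpose B ** B) *v y)" for B :: "real^6^6"
    by (metis dot_lmul_matrix matrix_vector_mul_assoc transpose_matrix_vector transpose_transpose)
  have "transpose (\<sigma> ** A) ** (\<sigma> ** A) = transpose \<sigma> ** \<sigma>"
    using assms
    by (simp add: metric_orthogonal_group_def metric_mat_def matrix_transpose_mul matrix_mul_assoc)
  then show ?thesis
    by (simp add: matrix_vector_mul_assoc gram)
qed

theorem theorem5p1:
  fixes L :: "'a::euclidean_space \<Rightarrow> 'a \<Rightarrow> 'a"
    and T :: "int list list" and F :: "nat set"
    and \<theta> :: "'a \<Rightarrow> real^6" and \<sigma> :: "real^6^6"
  assumes "cslat L" and "DIM('a) = 6"
    and "\<not> lie_isomorphic L h13"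
    and "\<not> lie_isomorphic L h19_plus"
    and "\<not> lie_isomorphic L h26_minus"
    and "(T, F) \<in> cslat_table" and "lie_iso L (tuple_bracket T) \<theta>"
    and "\<sigma> \<in> Sigma_mats F"
  shows "isotropy_group L \<theta> \<sigma> \<subseteq> diagonal_sign_auts L \<theta>"
proof
  fix \<phi> assume \<phi>: "\<phi> \<in> isotropy_group L \<theta> \<sigma>"
  then have aut: "\<phi> \<in> lie_aut L"
    and lin\<phi>: "linear \<phi>" and bij\<phi>: "bij \<phi>" and hom\<phi>: "\<And>x y. \<phi> (L x y) = L (\<phi> x) (\<phi> y)"
    by (auto simp: isotropy_group_def lie_aut_def lie_iso_def)
  from assms(7) have lin\<theta>: "linear \<theta>" and bij\<theta>: "bij \<theta>"
    and hom\<theta>: "\<And>x y. \<theta> (L x y) = tuple_bracket T (\<theta> x) (\<theta> y)"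
    by (auto simp: lie_iso_def)
  define \<psi> where "\<psi> = \<theta> \<circ> \<phi> \<circ> inv \<theta>"
  have inv\<theta>: "\<theta> (inv \<theta> x) = x" "inv \<theta> (\<theta> y) = y" for x y
    using bij\<theta> by (simp_all add: bij_is_surj surj_f_inv_f bij_is_inj inv_f_f)
  have "linear (inv \<theta>)"
  proof
    show "inv \<theta> (x + y) = inv \<theta> x + inv \<theta> y" for x y
    proof -
      have "inv \<theta> (x + y) = inv \<theta> (\<theta> (inv \<theta> x + inv \<theta> y))"
        by (simp only: linear_add[OF lin\<theta>] inv\<theta>(1))
      then show ?thesis by (simp only: inv\<theta>(2))
    qed
    show "inv \<theta> (c *\<^sub>R x) = c *\<^sub>R inv \<theta> x" for c x
    proof -
      have "inv \<theta> (c *\<^sub>R x) = inv \<theta> (\<theta> (c *\<^sub>R inv \<theta> x))"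
        by (simp only: linear_scale[OF lin\<theta>] inv\<theta>(1))
      then show ?thesis by (simp only: inv\<theta>(2))
    qed
  qed
  then have lin\<psi>: "linear \<psi>"
    unfolding \<psi>_def by (intro linear_compose lin\<theta> lin\<phi>)
  have "inv \<theta> (tuple_bracket T x y) = L (inv \<theta> x) (inv \<theta> y)" for x y
  proof -
    have "inv \<theta> (tuple_bracket T x y) = inv \<theta> (\<theta> (L (inv \<theta> x) (inv \<theta> y)))"
      by (simp only: hom\<theta> inv\<theta>(1))
    then show ?thesis by (simp only: inv\<theta>(2))
  qed
  then have hom\<psi>: "\<psi> (tuple_bracket T x y) = tuple_bracket T (\<psi> x) (\<psi> y)" for x y
    by (simp add: \<psi>_def hom\<phi> hom\<theta>)
  interpret tuple_isometry T \<psi> F \<sigma>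
  proof (intro tuple_isometry.intro tuple_automorphism.intro tuple_isometry_axioms.intro)
    show "linear \<psi>" by (rule lin\<psi>)
    show "bij \<psi>"
      unfolding \<psi>_def by (intro bij_comp bij_imp_bij_inv bij\<theta> bij\<phi>)
    show "\<psi> (tuple_bracket T x y) = tuple_bracket T (\<psi> x) (\<psi> y)" for x y by (rule hom\<psi>)
    show "\<sigma> \<in> Sigma_mats F" by (rule assms(8))
    have "matrix \<psi> \<in> metric_orthogonal_group (metric_mat \<sigma>)"
      using \<phi> by (simp add: isotropy_group_def matrix_in_std_basis_def \<psi>_def)
    from metric_orthogonal_isometry[OF this]
    show "(\<sigma> *v \<psi> x) \<bullet> (\<sigma> *v \<psi> y) = (\<sigma> *v x) \<bullet> (\<sigma> *v y)" for x y
      by (simp add: matrix_works lin\<psi>)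
  qed
  have diag: "\<forall>k\<in>{1..6}. \<exists>\<epsilon>\<in>{1, -1}. \<psi> (std_basis k) = \<epsilon> *\<^sub>R std_basis k"
    using sign_diagonal_table[OF assms(6)] by (simp add: sign_diagonal_def)
  have axes: "\<forall>j. \<exists>\<epsilon>\<in>{1, -1}. \<psi> (axis j 1) = \<epsilon> *\<^sub>R axis j 1"
    unfolding all_positions using diag by (simp only: std_basis_def)
  have entries: "(i \<noteq> j \<longrightarrow> matrix \<psi> $ i $ j = 0) \<and> matrix \<psi> $ i $ i \<in> {1, -1}" for i j
  proof -
    have entry: "\<exists>\<epsilon>\<in>{1, -1}. matrix \<psi> $ k $ j = \<epsilon> * (if k = j then 1 else 0)" for j k
    proof -
      obtain \<epsilon> where "\<epsilon> \<in> {1, -1}" "\<psi> (axis j 1) = \<epsilon> *\<^sub>R axis j 1"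
        using axes by blast
      then show ?thesis
        by (auto simp: matrix_def axis_def)
    qed
    show ?thesis
      using entry[of i j] entry[of i i] by auto
  qed
  show "\<phi> \<in> diagonal_sign_auts L \<theta>"
    unfolding diagonal_sign_auts_def matrix_in_std_basis_def \<psi>_def[symmetric] mem_Collect_eq
    by (intro conjI allI aut entries[THEN conjunct1] entries[THEN conjunct2])
qed

end
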